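(* In the setup of the context, let $s$ be a positive integer satisfying (C0) $\max_{i\in\{0,1\}}\bigl\{N(\mathbf n,\mathbf e_i)-\sum_{j\in\Lambda_i} n_j+1\bigr\}\le s$, and (C1) $n_{\Lambda_i[0]}\ge N(\mathbf n,\mathbf e_i)-s>0$ for each $i\in\{0,1\}$. Then $\dim\sigma_s(X_{\mathbf n,\mathbf d})\le F(\mathbf n,\mathbf e_0,\mathbf e_1)$, where $$F(\mathbf n,\mathbf e_0,\mathbf e_1)=s\,[D(\mathbf n)-E(\mathbf n)]+N(\mathbf n,\mathbf d)-1-\sum_{i\in\{0,1\}}N(\mathbf n,\mathbf e_{1-i})\,[N(\mathbf n,\mathbf e_i)-s]+\prod_{i\in\{0,1\}}[N(\mathbf n,\mathbf e_i)-s],$$ and $E(\mathbf n)=D(\mathbf n)-\sum_{i\in\{0,1\}}(N(\mathbf n,\mathbf e_i)-s)$.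
   Context: $K$ is an algebraically closed field of characteristic $0$. For $k$-tuples $\mathbf n=(n_0,\dots,n_{k-1})$, $\mathbf d=(d_0,\dots,d_{k-1})$ of non-negative integers set $N(\mathbf n,\mathbf d)=\prod_{i=0}^{k-1}\binom{n_i+d_i}{d_i}$ and $D(\mathbf n)=\sum_{i=0}^{k-1}n_i$. For positive $\mathbf n,\mathbf d$, let $V_i$ be a $K$-vector space of dimension $n_i+1$; the Segre–Veronese variety $X_{\mathbf n,\mathbf d}\subset\mathbb P\bigl(\bigotimes_{i}\mathrm{Sym}_{d_i}V_i\bigr)\cong\mathbb P^{N(\mathbf n,\mathbf d)-1}$ is the image of $\prod_i\mathbb P V_i$ under $([u_0],\dots,[u_{k-1}])\mapsto[u_0^{d_0}\otimes\cdots\otimes u_{k-1}^{d_{k-1}}]$; it has dimension $D(\mathbf n)$. The $s$-th secant variety $\sigma_s(X)$ is the Zariski closure of the union of all linear spans of $s$ linearly independent points of $X$. Standing setup: $k\ge2$, $\mathbf n$ positive, $\mathbf d=(1,\dots,1,d_{k-1})$ with $d_{k-1}\ge2$; $\mathbf e_0\in\mathbb Z_{\ge0}^k$ with $\mathbf e_0[j]\le\mathbf d[j]$ for all $j$ and $1\le\mathbf e_0[k-1]\le d_{k-1}-1$; $\mathbf e_1=\mathbf d-\mathbf e_0$. For $i\in\{0,1\}$, $\Lambda_i=\{j:\mathbf e_i[j]\ne0\}$, listed increasingly, $\Lambda_i[0]$ its smallest element; it is assumed that $\Lambda_i$ contains at least one index $\le k-2$. *)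

theory Defs
  imports "HOL-Library.Extended_Real" "HOL-Computational_Algebra.Polynomial"
begin

definition alg_closed :: "'a::field itself \<Rightarrow> bool" where
  "alg_closed _ \<longleftrightarrow> (\<forall>p::'a poly. degree p \<noteq> 0 \<longrightarrow> (\<exists>x. poly p x = 0))"

(* tuples are functions nat => nat, only the entries < k matter *)
definition Nnd :: "nat \<Rightarrow> (nat \<Rightarrow> nat) \<Rightarrow> (nat \<Rightarrow> nat) \<Rightarrow> nat" where
  "Nnd k n d = (\<Prod>i<k. (n i + d i) choose (d i))"

definition Dn :: "nat \<Rightarrow> (nat \<Rightarrow> nat) \<Rightarrow> nat" where
  "Dn k n = (\<Sum>i<k. n i)"

definition Lam :: "nat \<Rightarrow> (nat \<Rightarrow> nat) \<Rightarrow> nat set" where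
  "Lam k e = {j. j < k \<and> e j \<noteq> 0}"

(* Coordinates of the ambient space (tensor product of Sym_{d_i} V_i): monomial basis,
   indexed by tuples of exponent vectors alpha i j (i<k, j<=n i) with sum_j alpha i j = d i *)
type_synonym idx = "nat \<Rightarrow> nat \<Rightarrow> nat"

definition SVidx :: "nat \<Rightarrow> (nat \<Rightarrow> nat) \<Rightarrow> (nat \<Rightarrow> nat) \<Rightarrow> idx set" where
  "SVidx k n d = {\<alpha>. (\<forall>i\<ge>k. \<forall>j. \<alpha> i j = 0) \<and>
      (\<forall>i<k. (\<forall>j>n i. \<alpha> i j = 0) \<and> (\<Sum>j\<le>n i. \<alpha> i j) = d i)}"

definition ambient :: "idx set \<Rightarrow> (idx \<Rightarrow> 'a::zero) set" where
  "ambient I = {x. \<forall>\<alpha>. \<alpha> \<notin> I \<longrightarrow> x \<alpha> = 0}"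

inductive_set polyfun :: "idx set \<Rightarrow> ((idx \<Rightarrow> 'a::comm_ring_1) \<Rightarrow> 'a) set" for I where
  pf_const: "(\<lambda>x. c) \<in> polyfun I"
| pf_var: "\<alpha> \<in> I \<Longrightarrow> (\<lambda>x. x \<alpha>) \<in> polyfun I"
| pf_add: "p \<in> polyfun I \<Longrightarrow> q \<in> polyfun I \<Longrightarrow> (\<lambda>x. p x + q x) \<in> polyfun I"
| pf_mult: "p \<in> polyfun I \<Longrightarrow> q \<in> polyfun I \<Longrightarrow> (\<lambda>x. p x * q x) \<in> polyfun I"

definition zariski_closed :: "idx set \<Rightarrow> (idx \<Rightarrow> 'a::comm_ring_1) set \<Rightarrow> bool" where
  "zariski_closed I Y \<longleftrightarrow> (\<exists>P \<subseteq> polyfun I. Y = {x \<in> ambient I. \<forall>p\<in>P. p x = 0})"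

definition zariski_closure :: "idx set \<Rightarrow> (idx \<Rightarrow> 'a::comm_ring_1) set \<Rightarrow> (idx \<Rightarrow> 'a) set" where
  "zariski_closure I S = \<Inter> {Y. zariski_closed I Y \<and> S \<subseteq> Y}"

definition zariski_irreducible :: "idx set \<Rightarrow> (idx \<Rightarrow> 'a::comm_ring_1) set \<Rightarrow> bool" where
  "zariski_irreducible I Y \<longleftrightarrow> zariski_closed I Y \<and> Y \<noteq> {} \<and>
     (\<forall>A B. zariski_closed I A \<longrightarrow> zariski_closed I B \<longrightarrow> Y \<subseteq> A \<union> B \<longrightarrow> Y \<subseteq> A \<or> Y \<subseteq> B)"

definition krull_dim :: "idx set \<Rightarrow> (idx \<Rightarrow> 'a::comm_ring_1) set \<Rightarrow> enat" where
  "krull_dim I Y = Sup {enat m | m. \<exists>Z :: nat \<Rightarrow> (idx \<Rightarrow> 'a) set.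
      (\<forall>t\<le>m. zariski_irreducible I (Z t) \<and> Z t \<subseteq> Y) \<and> (\<forall>t<m. Z t \<subset> Z (Suc t))}"

(* affine cone over the Segre-Veronese variety X_{n,d}: nonzero rank-one points
   u_0^{d_0} (x) ... (x) u_{k-1}^{d_{k-1}} in monomial coordinates *)
definition SV_cone :: "nat \<Rightarrow> (nat \<Rightarrow> nat) \<Rightarrow> (nat \<Rightarrow> nat) \<Rightarrow> (idx \<Rightarrow> 'a::field) set" where
  "SV_cone k n d = {v. \<exists>u :: nat \<Rightarrow> nat \<Rightarrow> 'a.
      (\<forall>i<k. \<exists>j\<le>n i. u i j \<noteq> 0) \<and>
      v = (\<lambda>\<alpha>. if \<alpha> \<in> SVidx k n d then (\<Prod>i<k. \<Prod>j\<le>n i. u i j ^ \<alpha> i j) else 0)}"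

definition lin_indep :: "nat \<Rightarrow> (nat \<Rightarrow> idx \<Rightarrow> 'a::field) \<Rightarrow> bool" where
  "lin_indep s v \<longleftrightarrow> (\<forall>c. (\<forall>\<alpha>. (\<Sum>t<s. c t * v t \<alpha>) = 0) \<longrightarrow> (\<forall>t<s. c t = 0))"

definition secant_cone :: "nat \<Rightarrow> nat \<Rightarrow> (nat \<Rightarrow> nat) \<Rightarrow> (nat \<Rightarrow> nat) \<Rightarrow> (idx \<Rightarrow> 'a::field) set" where
  "secant_cone s k n d = zariski_closure (SVidx k n d)
     {w. \<exists>v c. (\<forall>t<s. v t \<in> SV_cone k n d) \<and> lin_indep s v \<and>
              w = (\<lambda>\<alpha>. \<Sum>t<s. c t * v t \<alpha>)}"

(* projective dimension of sigma_s(X) = dimension of the affine cone minus one *)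
definition secant_dim :: "'a::field itself \<Rightarrow> nat \<Rightarrow> nat \<Rightarrow> (nat \<Rightarrow> nat) \<Rightarrow> (nat \<Rightarrow> nat) \<Rightarrow> ereal" where
  "secant_dim _ s k n d =
     ereal_of_enat (krull_dim (SVidx k n d) (secant_cone s k n d :: (idx \<Rightarrow> 'a) set)) - 1"

end

theory Submission
  imports Defs "Jordan_Normal_Form.Determinant" "HOL-Computational_Algebra.Primes"
begin

text \<open>
  Writing \<open>a\<^sub>i = N(n, e\<^sub>i) - s\<close>, the bound simplifies to \<open>N(n, d) - 1 - a\<^sub>0 a\<^sub>1\<close>. On the cone over the
  secant variety the catalecticant matrix, with entry \<open>w (\<rho> + \<kappa>)\<close> in row \<open>\<rho>\<close> of multidegree \<open>e\<^sub>0\<close>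
  and column \<open>\<kappa>\<close> of multidegree \<open>e\<^sub>1\<close>, has rank at most \<open>s\<close>. By (C1) one can choose \<open>a\<^sub>0\<close> rows and
  \<open>a\<^sub>1\<close> columns whose monomials are pure powers of the first variable in the last block, the only
  block shared by \<open>e\<^sub>0\<close> and \<open>e\<^sub>1\<close>. The \<open>a\<^sub>0 a\<^sub>1\<close> coordinates at their crossings occur nowhere else in
  the matrix. If \<open>\<Delta>\<close> is the minor of the remaining \<open>s\<close> rows and columns, the vanishing of the minors
  bordering \<open>\<Delta>\<close> expresses each of these coordinates, times \<open>\<Delta>\<close>, through the other ones. Since \<open>\<Delta>\<close>
  is not a zero divisor on the secant variety, the dimension of the cone is at most the number of the
  other coordinates.
\<close>

section \<open>Polynomial functions\<close>

lemma polyfun_mono: "p \<in> polyfun I \<Longrightarrow> I \<subseteq> J \<Longrightarrow> p \<in> polyfun J"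
  by (induction rule: polyfun.induct) (auto intro: polyfun.intros)

lemma polyfun_sum:
  "(\<And>a. a \<in> A \<Longrightarrow> f a \<in> polyfun I) \<Longrightarrow> (\<lambda>x. \<Sum>a\<in>A. f a x) \<in> polyfun I"
proof (induction A rule: infinite_finite_induct)
  case (insert a A)
  then show ?case using pf_add[of "f a" I "\<lambda>x. \<Sum>a\<in>A. f a x"] by simp
qed (auto intro: pf_const)

lemma polyfun_prod:
  "(\<And>a. a \<in> A \<Longrightarrow> f a \<in> polyfun I) \<Longrightarrow> (\<lambda>x. \<Prod>a\<in>A. f a x) \<in> polyfun I"
proof (induction A rule: infinite_finite_induct)
  case (insert a A)
  then show ?case using pf_mult[of "f a" I "\<lambda>x. \<Prod>a\<in>A. f a x"] by simp
qed (auto intro: pf_const)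

lemma polyfun_power: "p \<in> polyfun I \<Longrightarrow> (\<lambda>x. p x ^ m) \<in> polyfun I"
  by (induction m) (auto intro: pf_const pf_mult)

lemma polyfun_monomial_sum:
  fixes m :: nat
  assumes "\<And>i. i < m \<Longrightarrow> f i \<in> polyfun I"
  shows "(\<lambda>x. \<Sum>b\<in>A. c b * (\<Prod>i<m. f i x ^ b i)) \<in> polyfun I"
proof (rule polyfun_sum, rule pf_mult)
  show "(\<lambda>x. c b) \<in> polyfun I" for b by (rule pf_const)
  show "(\<lambda>x. \<Prod>i<m. f i x ^ b i) \<in> polyfun I" for b
    using assms by (intro polyfun_prod polyfun_power) auto
qed

lemma polyfun_det:
  assumes "\<And>x. B x \<in> carrier_mat m m"
    and "\<And>i j. i < m \<Longrightarrow> j < m \<Longrightarrow> (\<lambda>x. B x $$ (i, j)) \<in> polyfun I"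
  shows "(\<lambda>x. det (B x)) \<in> polyfun I"
proof -
  have "(\<lambda>x. \<Sum>p\<in>{p. p permutes {0..<m}}. signof p * (\<Prod>i = 0..<m. B x $$ (i, p i))) \<in> polyfun I"
    by (intro polyfun_sum pf_mult pf_const polyfun_prod assms(2))
       (auto dest: permutes_in_image[of _ "{0..<m}"])
  then show ?thesis by (simp add: det_def'[OF assms(1)])
qed

section \<open>Irreducible sets and algebraic independence\<close>

lemma zariski_closed_zero_set:
  "p \<in> polyfun I \<Longrightarrow> zariski_closed I {x \<in> ambient I. p x = 0}"
  unfolding zariski_closed_def by (rule exI[of _ "{p}"]) auto

lemma vanish_on_zariski_closure:
  assumes "p \<in> polyfun I" "S \<subseteq> ambient I" "\<And>x. x \<in> S \<Longrightarrow> p x = 0"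
    and "y \<in> zariski_closure I S"
  shows "p y = 0"
  using assms zariski_closed_zero_set[OF assms(1)] unfolding zariski_closure_def by blast

text \<open>Functions on an irreducible set have no zero divisors: the two zero loci cover
  \<open>Z\<close>, so one of them contains it, and \<open>w\<close> excludes the locus of
  \<open>p\<close>.\<close>

lemma zariski_irreducible_cancel:
  fixes p q :: "(idx \<Rightarrow> 'a::idom) \<Rightarrow> 'a"
  assumes "zariski_irreducible I Z" "p \<in> polyfun I" "q \<in> polyfun I"
    and "\<And>z. z \<in> Z \<Longrightarrow> p z * q z = 0" and "w \<in> Z" "p w \<noteq> 0" and "z \<in> Z"
  shows "q z = 0"
proof -
  have "Z \<subseteq> ambient I"
    using assms(1) unfolding zariski_irreducible_def zariski_closed_def by auto
  then have "Z \<subseteq> {x \<in> ambient I. p x = 0} \<union> {x \<in> ambient I. q x = 0}"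
    using assms(4) by auto
  then show ?thesis
    using assms zariski_closed_zero_set[OF assms(2)] zariski_closed_zero_set[OF assms(3)]
    unfolding zariski_irreducible_def by blast
qed

lemma separating_polyfun:
  assumes "zariski_closed I Z" "zariski_closed I Z'" "Z \<subset> Z'"
  obtains p z where "p \<in> polyfun I" "\<And>x. x \<in> Z \<Longrightarrow> p x = 0" "z \<in> Z'" "p z \<noteq> 0"
proof -
  obtain P where P: "P \<subseteq> polyfun I" "Z = {x \<in> ambient I. \<forall>p\<in>P. p x = 0}"
    using assms(1) unfolding zariski_closed_def by auto
  obtain z where z: "z \<in> Z'" "z \<notin> Z" using assms(3) by auto
  have "z \<in> ambient I" using assms(2) z unfolding zariski_closed_def by auto
  with z P obtain p where "p \<in> P" "p z \<noteq> 0" by auto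
  then show ?thesis using that P z by blast
qed

lemma prod_power_fun_upd:
  fixes m :: nat
  shows "(\<Prod>i<Suc m. f i ^ (b(m := l)) i) = (f m ^ l * (\<Prod>i<m. f i ^ b i) :: 'a::comm_monoid_mult)"
  by (simp add: mult.commute)

text \<open>Splitting off the last exponent lets a sum over monomials in \<open>m + 1\<close>
  functions be read as a polynomial in the last function.\<close>

lemma sum_funcset_Suc:
  fixes m q :: nat
  shows "(\<Sum>b\<in>{..<Suc m} \<rightarrow>\<^sub>E {..q}. g b)
    = (\<Sum>l<Suc q. \<Sum>b\<in>{..<m} \<rightarrow>\<^sub>E {..q}. g (b(m := l)) :: 'a::comm_monoid_add)"
proof -
  have "(\<Sum>b\<in>{..<Suc m} \<rightarrow>\<^sub>E {..q}. g b)
      = sum g ((\<lambda>(l, b). b(m := l)) ` ({..q} \<times> ({..<m} \<rightarrow>\<^sub>E {..q})))"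
    by (simp add: lessThan_Suc PiE_insert_eq)
  also have "\<dots> = (\<Sum>(l, b)\<in>{..q} \<times> ({..<m} \<rightarrow>\<^sub>E {..q}). g (b(m := l)))"
    by (subst sum.reindex) (auto intro!: inj_combinator sum.cong)
  finally show ?thesis by (simp add: sum.cartesian_product lessThan_Suc_atMost)
qed

text \<open>The \<open>m\<close>-th function vanishes on \<open>Z m\<close>, so setting it to zero peels off the terms of lowest
  order in it; irreducibility of \<open>Z (Suc m)\<close> allows dividing by it.\<close>

lemma chain_algebraically_independent:
  fixes Z :: "nat \<Rightarrow> (idx \<Rightarrow> 'a::idom) set"
  assumes irr: "\<And>t. t \<le> m \<Longrightarrow> zariski_irreducible I (Z t)"
    and sub: "\<And>t. t < m \<Longrightarrow> Z t \<subseteq> Z (Suc t)"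
    and f: "\<And>t. t < m \<Longrightarrow> f t \<in> polyfun I"
    and f0: "\<And>t x. t < m \<Longrightarrow> x \<in> Z t \<Longrightarrow> f t x = 0"
    and f1: "\<And>t. t < m \<Longrightarrow> \<exists>x\<in>Z (Suc t). f t x \<noteq> 0"
    and van: "\<And>z. z \<in> Z m \<Longrightarrow> (\<Sum>b\<in>{..<m} \<rightarrow>\<^sub>E {..q}. c b * (\<Prod>i<m. f i z ^ b i)) = 0"
    and b: "b \<in> {..<m} \<rightarrow>\<^sub>E {..q}"
  shows "c b = 0"
  using assms
proof (induction m arbitrary: c b)
  case 0
  \<comment> \<open>Irreducible sets are nonempty. With no functions the only term is the constant
    one, indexed by the empty tuple.\<close>
  obtain z where "z \<in> Z 0" using 0(1)[of 0] unfolding zariski_irreducible_def by auto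
  from 0(6)[OF this] have "c (\<lambda>_. undefined) = 0" by simp
  moreover have "b = (\<lambda>_. undefined)" using 0(7) by simp
  ultimately show ?case by (simp only:)
next
  case (Suc m)
  define g where "g a z = (\<Sum>b\<in>{..<m} \<rightarrow>\<^sub>E {..q}. a b * (\<Prod>i<m. f i z ^ b i))" for a z
  have gp: "g a \<in> polyfun I" for a
    unfolding g_def by (rule polyfun_monomial_sum) (use Suc.prems(3) in auto)
  have g0: "a b = 0" if "\<And>z. z \<in> Z m \<Longrightarrow> g a z = 0" "b \<in> {..<m} \<rightarrow>\<^sub>E {..q}" for a b
    by (rule Suc.IH[of a b]) (use Suc.prems that in \<open>auto simp: g_def\<close>)
  obtain w where w: "w \<in> Z (Suc m)" "f m w \<noteq> 0" using Suc.prems(5)[of m] by auto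
  have fm: "f m \<in> polyfun I" and irrm: "zariski_irreducible I (Z (Suc m))"
    and subm: "Z m \<subseteq> Z (Suc m)" and fm0: "\<And>z. z \<in> Z m \<Longrightarrow> f m z = 0"
    using Suc.prems(1-4) by auto
  \<comment> \<open>Stated for all coefficient families \<open>h\<close>, since dividing by
    \<open>f m\<close> shifts the family by one.\<close>
  have main: "\<forall>l<L. \<forall>b\<in>{..<m} \<rightarrow>\<^sub>E {..q}. h l b = 0"
    if "\<And>z. z \<in> Z (Suc m) \<Longrightarrow> (\<Sum>l<L. f m z ^ l * g (h l) z) = 0" for L h
    using that
  proof (induction L arbitrary: h)
    case (Suc L)
    have split: "(\<Sum>l<Suc L. f m z ^ l * g (h l) z)
        = g (h 0) z + f m z * (\<Sum>l<L. f m z ^ l * g (h (Suc l)) z)" for z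
      unfolding sum.lessThan_Suc_shift by (simp add: sum_distrib_left mult.assoc)
    have h0: "h 0 b = 0" if "b \<in> {..<m} \<rightarrow>\<^sub>E {..q}" for b
    proof (rule g0[OF _ that])
      fix z assume z: "z \<in> Z m"
      then have "z \<in> Z (Suc m)" "f m z = 0" using subm fm0 by auto
      then show "g (h 0) z = 0" using Suc.prems[of z] split[of z] by simp
    qed
    then have "g (h 0) z = 0" for z unfolding g_def by (intro sum.neutral) auto
    then have *: "f m z * (\<Sum>l<L. f m z ^ l * g (h (Suc l)) z) = 0" if "z \<in> Z (Suc m)" for z
      using Suc.prems[OF that] split[of z] by simp
    have gs: "(\<lambda>z. \<Sum>l<L. f m z ^ l * g (h (Suc l)) z) \<in> polyfun I"
      by (intro polyfun_sum pf_mult polyfun_power fm gp)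
    have "(\<Sum>l<L. f m z ^ l * g (h (Suc l)) z) = 0" if "z \<in> Z (Suc m)" for z
      using zariski_irreducible_cancel[where p = "f m" and Z = "Z (Suc m)", OF irrm fm gs _ w that]
        * by blast
    from Suc.IH[of "\<lambda>l. h (Suc l)", OF this]
    have "\<forall>l<L. \<forall>b\<in>{..<m} \<rightarrow>\<^sub>E {..q}. h (Suc l) b = 0" .
    with h0 show ?case by (auto simp: less_Suc_eq_0_disj)
  qed simp
  have "(\<Sum>l<Suc q. f m z ^ l * g (\<lambda>b. c (b(m := l))) z) = 0" if "z \<in> Z (Suc m)" for z
    using Suc.prems(6)[OF that]
    unfolding sum_funcset_Suc prod_power_fun_upd g_def sum_distrib_left by (simp add: mult_ac)
  from main[of "\<lambda>l b. c (b(m := l))" "Suc q", OF this]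
  have z: "\<forall>l<Suc q. \<forall>b\<in>{..<m} \<rightarrow>\<^sub>E {..q}. c (b(m := l)) = 0" .
  obtain l b' where b: "b = b'(m := l)" and "l \<le> q" "b' \<in> {..<m} \<rightarrow>\<^sub>E {..q}"
    using Suc.prems(7) by (auto simp: lessThan_Suc PiE_insert_eq)
  then have "c (b'(m := l)) = 0" using z by simp
  then show ?case by (simp only: b)
qed

section \<open>Counting monomials\<close>

text \<open>Gaussian elimination by induction on the equations: \<open>a\<close> indexes the
  unknowns, \<open>b\<close> the equations. An unknown \<open>a0\<close> that occurs in equation
  \<open>b0\<close> is eliminated from the others.\<close>

lemma exists_nontrivial_kernel:
  fixes M :: "'i \<Rightarrow> 'j \<Rightarrow> 'a::field"
  assumes "finite B" "finite A" "card B < card A"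
  shows "\<exists>c. (\<exists>a\<in>A. c a \<noteq> 0) \<and> (\<forall>b\<in>B. (\<Sum>a\<in>A. c a * M a b) = 0)"
  using assms
proof (induction B arbitrary: A M rule: finite_induct)
  case empty
  then show ?case by (intro exI[of _ "\<lambda>_. 1"]) (auto simp: card_gt_0_iff)
next
  case (insert b0 B)
  show ?case
  proof (cases "\<forall>a\<in>A. M a b0 = 0")
    case True
    then show ?thesis using insert.IH[of A M] insert by auto
  next
    case False
    then obtain a0 where a0: "a0 \<in> A" "M a0 b0 \<noteq> 0" by auto
    define M' where "M' a b = M a b - M a b0 / M a0 b0 * M a0 b" for a b
    obtain c where c: "\<exists>a\<in>A - {a0}. c a \<noteq> 0" "\<forall>b\<in>B. (\<Sum>a\<in>A - {a0}. c a * M' a b) = 0"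
    proof -
      have "card B < card (A - {a0})" using insert.prems insert.hyps a0 by simp
      then show ?thesis using insert.IH[of "A - {a0}" M'] insert.prems that by blast
    qed
    \<comment> \<open>The value at \<open>a0\<close> is the one that solves equation
      \<open>b0\<close>.\<close>
    define d where "d = c(a0 := - (\<Sum>a\<in>A - {a0}. c a * M a b0) / M a0 b0)"
    have eq: "(\<Sum>a\<in>A. d a * M a b) = (\<Sum>a\<in>A - {a0}. c a * M' a b)" for b
    proof -
      have "(\<Sum>a\<in>A. d a * M a b) = d a0 * M a0 b + (\<Sum>a\<in>A - {a0}. d a * M a b)"
        by (rule sum.remove) (use insert.prems a0 in auto)
      also have "(\<Sum>a\<in>A - {a0}. d a * M a b) = (\<Sum>a\<in>A - {a0}. c a * M a b)"
        by (rule sum.cong) (auto simp: d_def)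
      also have "d a0 * M a0 b = - (\<Sum>a\<in>A - {a0}. c a * (M a b0 / M a0 b0 * M a0 b))"
        by (simp add: d_def sum_distrib_right sum_divide_distrib mult.assoc)
      finally show ?thesis by (simp add: M'_def algebra_simps sum_subtractf)
    qed
    have "M' a b0 = 0" for a using a0 by (simp add: M'_def)
    then have "\<forall>b\<in>insert b0 B. (\<Sum>a\<in>A. d a * M a b) = 0" using c eq by simp
    moreover have "\<exists>a\<in>A. d a \<noteq> 0" using c(1) by (auto simp: d_def)
    ultimately show ?thesis by blast
  qed
qed

section \<open>Polynomials with bounded exponents\<close>

definition monom_fun :: "idx set \<Rightarrow> (idx \<Rightarrow> nat) \<Rightarrow> (idx \<Rightarrow> 'a::comm_ring_1) \<Rightarrow> 'a" where
  "monom_fun J b x = (\<Prod>j\<in>J. x j ^ b j)"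

text \<open>The bound applies to each exponent separately instead of the total degree, so for finite
  \<open>J\<close> the monomials number exactly \<open>Suc q ^ card J\<close>.\<close>

definition polyfun_le :: "idx set \<Rightarrow> nat \<Rightarrow> ((idx \<Rightarrow> 'a::comm_ring_1) \<Rightarrow> 'a) set" where
  "polyfun_le J q = {p. \<exists>M. \<forall>x. p x = (\<Sum>b\<in>J \<rightarrow>\<^sub>E {..q}. M b * monom_fun J b x)}"

lemma polyfun_le_monom:
  assumes "finite J" "\<And>j. j \<in> J \<Longrightarrow> b j \<le> q"
  shows "(\<lambda>x. c * monom_fun J b x) \<in> polyfun_le J q"
proof -
  \<comment> \<open>The sum in \<open>polyfun_le\<close> ranges over extensional exponent functions;
    changing \<open>b\<close> off \<open>J\<close> leaves the monomial as it is.\<close>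
  let ?b = "restrict b J"
  have b: "?b \<in> J \<rightarrow>\<^sub>E {..q}" using assms by auto
  have "monom_fun J b x = monom_fun J ?b x" for x :: "idx \<Rightarrow> 'a"
    unfolding monom_fun_def by (rule prod.cong) auto
  then have "c * monom_fun J b x
      = (\<Sum>b'\<in>J \<rightarrow>\<^sub>E {..q}. (if b' = ?b then c else 0) * monom_fun J b' x)" for x
    using b assms(1) by (simp add: if_distrib[of "\<lambda>u. u * _"] sum.delta finite_PiE cong: if_cong)
  then show ?thesis unfolding polyfun_le_def
    by (intro CollectI exI[of _ "\<lambda>b'. if b' = ?b then c else 0"] allI)
qed

lemma polyfun_le_add:
  assumes "p \<in> polyfun_le J q" "p' \<in> polyfun_le J q"
  shows "(\<lambda>x. p x + p' x) \<in> polyfun_le J q"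
proof -
  obtain M M' where "\<forall>x. p x = (\<Sum>b\<in>J \<rightarrow>\<^sub>E {..q}. M b * monom_fun J b x)"
    "\<forall>x. p' x = (\<Sum>b\<in>J \<rightarrow>\<^sub>E {..q}. M' b * monom_fun J b x)"
    using assms unfolding polyfun_le_def by auto
  then have "\<forall>x. p x + p' x = (\<Sum>b\<in>J \<rightarrow>\<^sub>E {..q}. (M b + M' b) * monom_fun J b x)"
    by (simp add: sum.distrib distrib_right)
  then show ?thesis unfolding polyfun_le_def by (intro CollectI exI[of _ "\<lambda>b. M b + M' b"])
qed

lemma polyfun_le_const: "finite J \<Longrightarrow> (\<lambda>x. c) \<in> polyfun_le J q"
  using polyfun_le_monom[of J "\<lambda>_. 0" q c] by (simp add: monom_fun_def)

lemma polyfun_le_sum: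
  "finite J \<Longrightarrow> (\<And>a. a \<in> A \<Longrightarrow> f a \<in> polyfun_le J q) \<Longrightarrow> (\<lambda>x. \<Sum>a\<in>A. f a x) \<in> polyfun_le J q"
proof (induction A rule: infinite_finite_induct)
  case (insert a A)
  then show ?case using polyfun_le_add[of "f a" J q "\<lambda>x. \<Sum>a\<in>A. f a x"] by simp
qed (auto intro: polyfun_le_const)

lemma polyfun_le_mult:
  assumes "finite J" "p \<in> polyfun_le J q" "p' \<in> polyfun_le J q'"
  shows "(\<lambda>x. p x * p' x) \<in> polyfun_le J (q + q')"
proof -
  obtain M M' where M: "\<forall>x. p x = (\<Sum>b\<in>J \<rightarrow>\<^sub>E {..q}. M b * monom_fun J b x)"
    "\<forall>x. p' x = (\<Sum>b\<in>J \<rightarrow>\<^sub>E {..q'}. M' b * monom_fun J b x)"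
    using assms unfolding polyfun_le_def by auto
  have "p x * p' x = (\<Sum>b\<in>J \<rightarrow>\<^sub>E {..q}. \<Sum>b'\<in>J \<rightarrow>\<^sub>E {..q'}.
      (M b * M' b') * monom_fun J (\<lambda>j. b j + b' j) x)" for x
    unfolding M[rule_format] sum_product
    by (intro sum.cong refl) (simp add: monom_fun_def power_add prod.distrib mult_ac)
  moreover have "(\<lambda>x. \<Sum>b\<in>J \<rightarrow>\<^sub>E {..q}. \<Sum>b'\<in>J \<rightarrow>\<^sub>E {..q'}.
      (M b * M' b') * monom_fun J (\<lambda>j. b j + b' j) x) \<in> polyfun_le J (q + q')"
    by (intro polyfun_le_sum polyfun_le_monom) (use assms in \<open>auto intro!: add_mono dest: PiE_mem\<close>)
  ultimately show ?thesis by presburger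
qed

lemma polyfun_le_mono:
  assumes "finite J" "p \<in> polyfun_le J q" "q \<le> q'"
  shows "p \<in> polyfun_le J q'"
  using polyfun_le_mult[OF assms(1,2) polyfun_le_const[OF assms(1), of 1 "q' - q"]] assms(3) by simp

lemma polyfun_imp_polyfun_le:
  assumes "finite J" "p \<in> polyfun J"
  shows "\<exists>q. p \<in> polyfun_le J q"
  using assms(2)
proof (induction rule: polyfun.induct)
  case (pf_const c)
  then show ?case using polyfun_le_const[OF assms(1)] by blast
next
  case (pf_var j)
  have "monom_fun J (\<lambda>i. if i = j then 1 else 0) x = x j" for x :: "idx \<Rightarrow> 'a"
    using pf_var assms(1) by (simp add: monom_fun_def if_distrib[of "\<lambda>e. _ ^ e"] prod.delta cong: if_cong)
  moreover have "(\<lambda>x. 1 * monom_fun J (\<lambda>i. if i = j then 1 else 0) x :: 'a) \<in> polyfun_le J 1"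
    by (rule polyfun_le_monom[OF assms(1)]) simp
  ultimately show ?case by auto
next
  case (pf_add p p')
  then obtain q q' where "p \<in> polyfun_le J q" "p' \<in> polyfun_le J q'" by auto
  then have "p \<in> polyfun_le J (q + q')" "p' \<in> polyfun_le J (q + q')"
    by (auto elim: polyfun_le_mono[OF assms(1)])
  then show ?case using polyfun_le_add by blast
next
  case (pf_mult p p')
  then show ?case using polyfun_le_mult[OF assms(1)] by blast
qed

lemma polyfun_le_power:
  "finite J \<Longrightarrow> p \<in> polyfun_le J q \<Longrightarrow> (\<lambda>x. p x ^ m) \<in> polyfun_le J (m * q)"
proof (induction m)
  case (Suc m)
  then show ?case using polyfun_le_mult[of J p q "\<lambda>x. p x ^ m" "m * q"] by simp
qed (simp add: polyfun_le_const)

lemma polyfun_le_prod: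
  assumes "finite J" "\<And>i. i < (m::nat) \<Longrightarrow> f i \<in> polyfun_le J q"
  shows "(\<lambda>x. \<Prod>i<m. f i x) \<in> polyfun_le J (m * q)"
  using assms(2)
proof (induction m)
  case (Suc m)
  then have "(\<lambda>x. f m x * (\<Prod>i<m. f i x)) \<in> polyfun_le J (q + m * q)"
    by (intro polyfun_le_mult assms(1)) auto
  then show ?case by (simp add: mult.commute)
qed (simp add: polyfun_le_const assms)

section \<open>A dimension bound\<close>

text \<open>On \<open>Y\<close>, \<open>p\<close> is a fraction with numerator over \<open>J\<close>
  and denominator the \<open>l\<close>-th power of \<Delta>, written without division because
  \<Delta> may vanish at points of \<open>Y\<close>.\<close>

definition clears :: "idx set \<Rightarrow> (idx \<Rightarrow> 'a::comm_ring_1) set \<Rightarrow> ((idx \<Rightarrow> 'a) \<Rightarrow> 'a)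
    \<Rightarrow> ((idx \<Rightarrow> 'a) \<Rightarrow> 'a) \<Rightarrow> nat \<Rightarrow> bool" where
  "clears J Y \<Delta> p l \<longleftrightarrow> (\<exists>h\<in>polyfun J. \<forall>y\<in>Y. p y * \<Delta> y ^ l = h y)"

lemma clears_mult:
  assumes "clears J Y \<Delta> p l" "clears J Y \<Delta> q l'"
  shows "clears J Y \<Delta> (\<lambda>x. p x * q x) (l + l')"
proof -
  obtain h h' where h: "h \<in> polyfun J" "\<forall>y\<in>Y. p y * \<Delta> y ^ l = h y"
    "h' \<in> polyfun J" "\<forall>y\<in>Y. q y * \<Delta> y ^ l' = h' y"
    using assms unfolding clears_def by auto
  have "(p y * q y) * \<Delta> y ^ (l + l') = h y * h' y" if "y \<in> Y" for y
  proof -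
    have "(p y * q y) * \<Delta> y ^ (l + l') = (p y * \<Delta> y ^ l) * (q y * \<Delta> y ^ l')"
      by (simp add: power_add mult_ac)
    with h that show ?thesis by simp
  qed
  with pf_mult[OF h(1,3)] show ?thesis unfolding clears_def by auto
qed

lemma clears_add:
  assumes "clears J Y \<Delta> p l" "clears J Y \<Delta> q l"
  shows "clears J Y \<Delta> (\<lambda>x. p x + q x) l"
proof -
  obtain h h' where h: "h \<in> polyfun J" "\<forall>y\<in>Y. p y * \<Delta> y ^ l = h y"
    "h' \<in> polyfun J" "\<forall>y\<in>Y. q y * \<Delta> y ^ l = h' y"
    using assms unfolding clears_def by auto
  with pf_add[OF h(1,3)] show ?thesis unfolding clears_def by (auto simp: distrib_right)
qed

lemma clears_polyfun: "p \<in> polyfun J \<Longrightarrow> clears J Y \<Delta> p 0"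
  unfolding clears_def by auto

lemma clears_mono:
  assumes "\<Delta> \<in> polyfun J" "clears J Y \<Delta> p l" "l \<le> l'"
  shows "clears J Y \<Delta> p l'"
proof -
  have "clears J Y \<Delta> (\<lambda>_. 1) (l' - l)"
    unfolding clears_def using polyfun_power[OF assms(1)] by auto
  from clears_mult[OF assms(2) this] show ?thesis using assms(3) by simp
qed

text \<open>Each coordinate has denominator exponent 0 or 1; products add exponents, and sums are
  first brought to a common exponent.\<close>

lemma polyfun_clears:
  assumes \<Delta>: "\<Delta> \<in> polyfun J"
    and num: "\<And>\<alpha>. \<alpha> \<in> I - J \<Longrightarrow> clears J Y \<Delta> (\<lambda>y. y \<alpha>) 1"
    and p: "p \<in> polyfun I"
  shows "\<exists>l. clears J Y \<Delta> p l"
  using p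
proof (induction rule: polyfun.induct)
  case (pf_const c)
  then show ?case using clears_polyfun[OF polyfun.pf_const] by blast
next
  case (pf_var \<alpha>)
  then show ?case using num[of \<alpha>] clears_polyfun[OF polyfun.pf_var, of \<alpha> J] by (cases "\<alpha> \<in> J") auto
next
  case (pf_add p q)
  then obtain l l' where "clears J Y \<Delta> p l" "clears J Y \<Delta> q l'" by auto
  then have "clears J Y \<Delta> p (l + l')" "clears J Y \<Delta> q (l + l')" using clears_mono[OF \<Delta>] by auto
  then show ?case using clears_add by blast
next
  case (pf_mult p q)
  then show ?case using clears_mult by blast
qed

text \<open>On \<open>Y\<close> all coordinates lie in the localisation at \<open>\<Delta>\<close> of the algebra generated by the
  coordinates in \<open>J\<close>. A strict chain of length \<open>m\<close> yields about \<open>q ^ m\<close> independent functions of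
  degree \<open>O(q)\<close>, and there are only \<open>O(q ^ card J)\<close> monomials in \<open>J\<close> of that degree.\<close>

theorem krull_dim_le_card:
  fixes Y :: "(idx \<Rightarrow> 'a::field) set"
  assumes fin: "finite J" and JI: "J \<subseteq> I" and \<Delta>: "\<Delta> \<in> polyfun J"
    and num: "\<And>\<alpha>. \<alpha> \<in> I - J \<Longrightarrow> clears J Y \<Delta> (\<lambda>y. y \<alpha>) 1"
    and nzd: "\<forall>p\<in>polyfun I. (\<forall>y\<in>Y. p y * \<Delta> y = 0) \<longrightarrow> (\<forall>y\<in>Y. p y = 0)"
  shows "krull_dim I Y \<le> enat (card J)"
  unfolding krull_dim_def
proof (rule Sup_least, clarify, rule ccontr)
  fix m and Z :: "nat \<Rightarrow> (idx \<Rightarrow> 'a) set"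
  assume Z: "\<forall>t\<le>m. zariski_irreducible I (Z t) \<and> Z t \<subseteq> Y" "\<forall>t<m. Z t \<subset> Z (Suc t)"
    and "\<not> enat m \<le> enat (card J)"
  then have m: "m > card J" by simp
  have "\<exists>p. p \<in> polyfun I \<and> (\<forall>x\<in>Z t. p x = 0) \<and> (\<exists>x\<in>Z (Suc t). p x \<noteq> 0)" if "t < m" for t
  proof -
    have "zariski_closed I (Z t)" "zariski_closed I (Z (Suc t))" "Z t \<subset> Z (Suc t)"
      using Z that unfolding zariski_irreducible_def by auto
    then show ?thesis by (rule separating_polyfun) blast
  qed
  then obtain f where f: "\<And>t. t < m \<Longrightarrow> f t \<in> polyfun I"
    "\<And>t x. t < m \<Longrightarrow> x \<in> Z t \<Longrightarrow> f t x = 0" "\<And>t. t < m \<Longrightarrow> \<exists>x\<in>Z (Suc t). f t x \<noteq> 0"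
    by metis
  \<comment> \<open>A single exponent \<open>L\<close> serves all \<open>f t\<close>: the sum of the
    individual exponents bounds each of them.\<close>
  obtain L where "\<And>t. t < m \<Longrightarrow> clears J Y \<Delta> (f t) L"
  proof -
    have "\<forall>t. \<exists>l. t < m \<longrightarrow> clears J Y \<Delta> (f t) l" using polyfun_clears[OF \<Delta> num f(1)] by auto
    then obtain l where l: "\<And>t. t < m \<Longrightarrow> clears J Y \<Delta> (f t) (l t)" by metis
    have "l t \<le> (\<Sum>t<m. l t)" if "t < m" for t using that by (intro member_le_sum) auto
    then show ?thesis using that clears_mono[OF \<Delta> l] by blast
  qed
  then have "\<forall>t. \<exists>h. t < m \<longrightarrow> h \<in> polyfun J \<and> (\<forall>y\<in>Y. f t y * \<Delta> y ^ L = h y)"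
    unfolding clears_def by blast
  then obtain g where g: "\<And>t. t < m \<Longrightarrow> g t \<in> polyfun J"
    "\<And>t y. t < m \<Longrightarrow> y \<in> Y \<Longrightarrow> f t y * \<Delta> y ^ L = g t y"
    by metis
  have \<Delta>L: "(\<lambda>y. \<Delta> y ^ L) \<in> polyfun J" using \<Delta> by (rule polyfun_power)
  obtain \<delta> where \<delta>: "\<And>t. t < m \<Longrightarrow> g t \<in> polyfun_le J \<delta>" "(\<lambda>y. \<Delta> y ^ L) \<in> polyfun_le J \<delta>"
  proof -
    have "\<forall>t. \<exists>q. t < m \<longrightarrow> g t \<in> polyfun_le J q"
      using polyfun_imp_polyfun_le[OF fin] g(1) by blast
    then obtain q where q: "\<And>t. t < m \<Longrightarrow> g t \<in> polyfun_le J (q t)" by metis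
    obtain q' where q': "(\<lambda>y. \<Delta> y ^ L) \<in> polyfun_le J q'"
      using polyfun_imp_polyfun_le[OF fin \<Delta>L] by blast
    have "q t \<le> (\<Sum>t<m. q t) + q'" if "t < m" for t
      using member_le_sum[of t "{..<m}" q] that by auto
    then show ?thesis
      using that[of "(\<Sum>t<m. q t) + q'"] q q' polyfun_le_mono[OF fin] by (meson le_add2)
  qed
  \<comment> \<open>With this \<open>C\<close> one has
    \<open>Suc (m * (q * \<delta>)) \<le> C * Suc q\<close>, and \<open>q = C ^ card J\<close> makes
    the number of monomials over \<open>J\<close> at most \<open>q * Suc q ^ card J\<close>, just
    below \<open>Suc q ^ Suc (card J)\<close>.\<close>
  define C where "C = Suc (m * \<delta>)"
  define q where "q = C ^ card J"
  define A where "A = {..<m} \<rightarrow>\<^sub>E {..q}"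
  define B where "B = J \<rightarrow>\<^sub>E {..m * (q * \<delta>)}"
  have cA: "card A = Suc q ^ m" and fA: "finite A" unfolding A_def by (auto simp: card_funcsetE finite_PiE)
  have cB: "card B = Suc (m * (q * \<delta>)) ^ card J" and fB: "finite B"
    unfolding B_def using fin by (auto simp: card_funcsetE finite_PiE)
  have "card B \<le> (C * Suc q) ^ card J"
    unfolding cB by (rule power_mono) (auto simp: C_def algebra_simps)
  also have "\<dots> < Suc q * Suc q ^ card J"
    unfolding power_mult_distrib q_def[symmetric] by simp
  also have "\<dots> = Suc q ^ Suc (card J)" by simp
  also have "\<dots> \<le> card A" unfolding cA using m by (intro power_increasing) auto
  finally have less: "card B < card A" .
  \<comment> \<open>The monomial of the \<open>f i\<close> brought to a common denominator: factor
    \<open>i\<close> receives \<open>q\<close> copies of \<open>\<Delta> y ^ L\<close>, of which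
    \<open>b i\<close> turn \<open>f i\<close> into \<open>g i\<close>. The total power of \<Delta>
    is then the same for all \<open>b\<close>.\<close>
  define G where "G b y = (\<Prod>i<m. g i y ^ b i * (\<Delta> y ^ L) ^ (q - b i))" for b y
  have "G b \<in> polyfun_le J (m * (q * \<delta>))" if "b \<in> A" for b
    unfolding G_def
  proof (intro polyfun_le_prod fin)
    fix i assume i: "i < m"
    have "b i \<le> q" using PiE_mem[OF that[unfolded A_def], of i] i by simp
    then have "q * \<delta> = b i * \<delta> + (q - b i) * \<delta>" by (simp flip: add_mult_distrib)
    then show "(\<lambda>x. g i x ^ b i * (\<Delta> x ^ L) ^ (q - b i)) \<in> polyfun_le J (q * \<delta>)"
      using polyfun_le_mult[OF fin polyfun_le_power[OF fin \<delta>(1)[OF i]] polyfun_le_power[OF fin \<delta>(2)]]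
      by simp
  qed
  then have "\<forall>b. \<exists>M. b \<in> A \<longrightarrow> (\<forall>x. G b x = (\<Sum>b'\<in>B. M b' * monom_fun J b' x))"
    unfolding polyfun_le_def B_def by blast
  then obtain M where M: "\<And>b x. b \<in> A \<Longrightarrow> G b x = (\<Sum>b'\<in>B. M b b' * monom_fun J b' x)" by metis
  \<comment> \<open>There are more functions \<open>G b\<close> than monomials to express them in,
    so they satisfy a linear relation.\<close>
  obtain c where c: "\<exists>b\<in>A. c b \<noteq> 0" "\<forall>b'\<in>B. (\<Sum>b\<in>A. c b * M b b') = 0"
    using exists_nontrivial_kernel[OF fB fA less, of M] by (elim exE conjE)
  define p where "p y = (\<Sum>b\<in>A. c b * (\<Prod>i<m. f i y ^ b i))" for y
  have pp: "p \<in> polyfun I" unfolding p_def by (rule polyfun_monomial_sum) (rule f(1))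
  have p0: "p y * \<Delta> y ^ (L * (q * m)) = 0" if y: "y \<in> Y" for y
  proof -
    have "(\<Prod>i<m. f i y ^ b i) * \<Delta> y ^ (L * (q * m)) = G b y" if b: "b \<in> A" for b
    proof -
      have "G b y = (\<Prod>i<m. f i y ^ b i * ((\<Delta> y ^ L) ^ b i * (\<Delta> y ^ L) ^ (q - b i)))"
        unfolding G_def
      proof (rule prod.cong[OF refl])
        fix i assume "i \<in> {..<m}"
        then have "g i y = f i y * \<Delta> y ^ L" using g(2)[OF _ y] by simp
        then show "g i y ^ b i * (\<Delta> y ^ L) ^ (q - b i)
            = f i y ^ b i * ((\<Delta> y ^ L) ^ b i * (\<Delta> y ^ L) ^ (q - b i))"
          by (simp only: power_mult_distrib mult.assoc)
      qed
      also have "\<dots> = (\<Prod>i<m. f i y ^ b i * (\<Delta> y ^ L) ^ q)"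
      proof (rule prod.cong[OF refl])
        fix i assume "i \<in> {..<m}"
        then have "b i + (q - b i) = q" using PiE_mem[OF b[unfolded A_def], of i] by simp
        then show "f i y ^ b i * ((\<Delta> y ^ L) ^ b i * (\<Delta> y ^ L) ^ (q - b i)) = f i y ^ b i * (\<Delta> y ^ L) ^ q"
          by (simp only: flip: power_add)
      qed
      finally show ?thesis by (simp add: prod.distrib power_mult)
    qed
    then have "p y * \<Delta> y ^ (L * (q * m)) = (\<Sum>b\<in>A. c b * G b y)"
      by (simp add: p_def sum_distrib_right mult.assoc)
    also have "\<dots> = (\<Sum>b\<in>A. \<Sum>b'\<in>B. c b * M b b' * monom_fun J b' y)"
      by (simp add: M sum_distrib_left mult.assoc)
    also have "\<dots> = (\<Sum>b'\<in>B. (\<Sum>b\<in>A. c b * M b b') * monom_fun J b' y)"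
      by (subst sum.swap) (simp add: sum_distrib_right)
    finally show ?thesis using c(2) by simp
  qed
  have "\<forall>y\<in>Y. p y = 0"
  proof -
    \<comment> \<open>\<Delta> is cancelled one power at a time, as \<open>nzd\<close> speaks of a
      single factor.\<close>
    have "(\<And>y. y \<in> Y \<Longrightarrow> p y * \<Delta> y ^ l = 0) \<Longrightarrow> \<forall>y\<in>Y. p y = 0" for l
    proof (induction l)
      case (Suc l)
      have pl: "(\<lambda>y. p y * \<Delta> y ^ l) \<in> polyfun I"
        by (rule pf_mult[OF pp polyfun_power[OF polyfun_mono[OF \<Delta> JI]]])
      have "\<forall>y\<in>Y. p y * \<Delta> y ^ l * \<Delta> y = 0" using Suc.prems by (simp add: mult_ac)
      then have "\<forall>y\<in>Y. p y * \<Delta> y ^ l = 0"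
        by (rule mp[OF bspec[where x = "\<lambda>y. p y * \<Delta> y ^ l", OF nzd pl]])
      then show ?case by (intro Suc.IH) blast
    qed simp
    then show ?thesis using p0 by blast
  qed
  \<comment> \<open>\<open>Z m\<close> lies in \<open>Y\<close>, so the relation holds there, and
    independence along the chain makes it trivial.\<close>
  then have "c b = 0" if "b \<in> A" for b
    by (intro chain_algebraically_independent[of m I Z f c q b])
       (use Z f that in \<open>auto simp: p_def A_def\<close>)
  with c(1) show False by blast
qed

section \<open>Counting coordinates\<close>

definition expvecs :: "nat \<Rightarrow> nat \<Rightarrow> (nat \<Rightarrow> nat) set" where
  "expvecs m e = {f. (\<forall>j>m. f j = 0) \<and> (\<Sum>j\<le>m. f j) = e}"

text \<open>Stars and bars: exponent vectors in the \<open>m + 1\<close> variables 0 to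
  \<open>m\<close> correspond to lists of length \<open>Suc m\<close> with sum
  \<open>e\<close>.\<close>

lemma card_expvecs: "card (expvecs m e) = (m + e) choose e"
proof -
  have "bij_betw (\<lambda>f. map f [0..<Suc m]) (expvecs m e) {l. length l = Suc m \<and> sum_list l = e}"
  proof (rule bij_betw_byWitness[where f' = "\<lambda>l j. if j \<le> m then l ! j else 0"])
    show "\<forall>f\<in>expvecs m e. (\<lambda>j. if j \<le> m then map f [0..<Suc m] ! j else 0) = f"
      by (auto simp: expvecs_def fun_eq_iff simp del: upt_Suc)
    show "\<forall>l\<in>{l. length l = Suc m \<and> sum_list l = e}.
        map (\<lambda>j. if j \<le> m then l ! j else 0) [0..<Suc m] = l"
      by (auto intro!: nth_equalityI simp del: upt_Suc)
    show "(\<lambda>f. map f [0..<Suc m]) ` expvecs m e \<subseteq> {l. length l = Suc m \<and> sum_list l = e}"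
      by (auto simp: expvecs_def interv_sum_list_conv_sum_set_nat atLeast0LessThan
          lessThan_Suc_atMost simp del: upt_Suc)
    show "(\<lambda>l j. if j \<le> m then l ! j else 0) ` {l. length l = Suc m \<and> sum_list l = e} \<subseteq> expvecs m e"
      by (auto simp: expvecs_def sum_list_sum_nth atLeast0LessThan lessThan_Suc_atMost)
  qed
  then show ?thesis
    by (simp add: bij_betw_same_card card_length_sum_list add.commute)
qed

text \<open>Cutting tuples off at \<open>k\<close> turns the index set into a product over the
  blocks, whose cardinality is the product of the binomials.\<close>

lemma SVidx_bij: "bij_betw (\<lambda>\<alpha>. restrict \<alpha> {..<k}) (SVidx k n d) (\<Pi>\<^sub>E i\<in>{..<k}. expvecs (n i) (d i))"
proof (rule bij_betw_byWitness[where f' = "\<lambda>g i. if i < k then g i else (\<lambda>_. 0)"])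
  show "\<forall>\<alpha>\<in>SVidx k n d. (\<lambda>i. if i < k then restrict \<alpha> {..<k} i else (\<lambda>_. 0)) = \<alpha>"
    by (auto simp: SVidx_def fun_eq_iff)
  show "\<forall>g\<in>\<Pi>\<^sub>E i\<in>{..<k}. expvecs (n i) (d i). restrict (\<lambda>i. if i < k then g i else (\<lambda>_. 0)) {..<k} = g"
    by (auto simp: fun_eq_iff restrict_def PiE_def extensional_def)
  show "(\<lambda>\<alpha>. restrict \<alpha> {..<k}) ` SVidx k n d \<subseteq> (\<Pi>\<^sub>E i\<in>{..<k}. expvecs (n i) (d i))"
    by (auto simp: SVidx_def expvecs_def)
  show "(\<lambda>g i. if i < k then g i else (\<lambda>_. 0)) ` (\<Pi>\<^sub>E i\<in>{..<k}. expvecs (n i) (d i)) \<subseteq> SVidx k n d"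
    by (auto simp: SVidx_def expvecs_def PiE_def Pi_def)
qed

lemma card_SVidx: "card (SVidx k n d) = Nnd k n d"
  using bij_betw_same_card[OF SVidx_bij] by (simp add: card_PiE card_expvecs Nnd_def)

lemma finite_SVidx: "finite (SVidx k n d)"
proof -
  \<comment> \<open>Infinite sets have cardinality 0 by convention, so a positive count proves
    finiteness.\<close>
  have "card (SVidx k n d) > 0" by (simp add: card_SVidx Nnd_def)
  then show ?thesis by (rule card_ge_0_finite)
qed

lemma SVidx_outside: "\<alpha> \<in> SVidx k n e \<Longrightarrow> k \<le> i \<Longrightarrow> \<alpha> i j = 0"
  by (simp add: SVidx_def)

lemma SVidx_zero: "\<alpha> \<in> SVidx k n e \<Longrightarrow> e i = 0 \<Longrightarrow> \<alpha> i j = 0"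
  by (cases "i < k"; cases "j \<le> n i") (auto simp: SVidx_def)

lemma SVidx_le: "\<alpha> \<in> SVidx k n e \<Longrightarrow> i < k \<Longrightarrow> \<alpha> i j \<le> e i"
  using member_le_sum[of j "{..n i}" "\<alpha> i"] by (cases "j \<le> n i") (auto simp: SVidx_def)

section \<open>Nonsingular matrices\<close>

lemma det_nonzero_iff:
  fixes a :: "nat \<Rightarrow> nat \<Rightarrow> 'a::field"
  shows "det (mat s s (\<lambda>(i, j). a i j)) \<noteq> 0
    \<longleftrightarrow> (\<forall>b. (\<forall>i<s. (\<Sum>j<s. a i j * b j) = 0) \<longrightarrow> (\<forall>j<s. b j = 0))"
    (is "det ?A \<noteq> 0 \<longleftrightarrow> ?R")
proof -
  have mv: "?A *\<^sub>v v = 0\<^sub>v s \<longleftrightarrow> (\<forall>i<s. (\<Sum>j<s. a i j * v $ j) = 0)" if "v \<in> carrier_vec s" for v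
    using that by (auto simp: vec_eq_iff scalar_prod_def atLeast0LessThan)
  have "det ?A = 0 \<longleftrightarrow> (\<exists>v. v \<in> carrier_vec s \<and> v \<noteq> 0\<^sub>v s \<and> ?A *\<^sub>v v = 0\<^sub>v s)"
    by (rule det_0_iff_vec_prod_zero_field) simp
  also have "\<dots> \<longleftrightarrow> \<not> ?R"
  proof
    assume "\<exists>v. v \<in> carrier_vec s \<and> v \<noteq> 0\<^sub>v s \<and> ?A *\<^sub>v v = 0\<^sub>v s"
    then obtain v where v: "v \<in> carrier_vec s" "v \<noteq> 0\<^sub>v s" "\<forall>i<s. (\<Sum>j<s. a i j * v $ j) = 0"
      using mv by blast
    then have "\<not> (\<forall>j<s. v $ j = 0)" by (auto simp: vec_eq_iff)
    with v(3) show "\<not> ?R" by (intro notI) (drule spec[of _ "\<lambda>j. v $ j"], auto)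
  next
    assume "\<not> ?R"
    then obtain b where b: "\<forall>i<s. (\<Sum>j<s. a i j * b j) = 0" "\<not> (\<forall>j<s. b j = 0)" by blast
    have "?A *\<^sub>v vec s b = 0\<^sub>v s" using b(1) by (subst mv) auto
    moreover have "vec s b \<noteq> 0\<^sub>v s" using b(2) by (auto simp: vec_eq_iff)
    ultimately show "\<exists>v. v \<in> carrier_vec s \<and> v \<noteq> 0\<^sub>v s \<and> ?A *\<^sub>v v = 0\<^sub>v s"
      by (intro exI[of _ "vec s b"]) auto
  qed
  finally show ?thesis by blast
qed

lemma det_mat_swap:
  "det (mat s s (\<lambda>(i, j). a j i)) = det (mat s s (\<lambda>(i, j). a i j :: 'a::comm_ring_1))"
proof -
  have "transpose_mat (mat s s (\<lambda>(i, j). a i j)) = mat s s (\<lambda>(i, j). a j i)"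
    by (rule eq_matI) auto
  then show ?thesis using det_transpose[of "mat s s (\<lambda>(i, j). a i j)" s] by simp
qed

text \<open>A kernel vector lists the coefficients of a polynomial of degree below \<open>s\<close>
  with the \<open>s\<close> distinct roots \<open>x i\<close>.\<close>

lemma vandermonde_det_nonzero:
  fixes x :: "nat \<Rightarrow> 'a::field"
  assumes "inj_on x {..<s}"
  shows "det (mat s s (\<lambda>(i, t). x i ^ t)) \<noteq> 0"
  unfolding det_nonzero_iff
proof (intro allI impI)
  fix b t assume b: "\<forall>i<s. (\<Sum>t<s. x i ^ t * b t) = 0" and t: "t < s"
  define p where "p = (\<Sum>t<s. monom (b t) t)"
  have "poly p (x i) = 0" if "i < s" for i
    using b that by (simp add: p_def poly_sum poly_monom mult.commute)
  moreover have "degree p < s"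
  proof -
    have "degree p \<le> s - 1" unfolding p_def
      by (rule degree_sum_le) (auto intro: order_trans[OF degree_monom_le])
    \<comment> \<open>\<open>t < s\<close> makes \<open>s\<close> positive, so \<open>s - 1\<close>
      is not truncated.\<close>
    then show ?thesis using t by linarith
  qed
  ultimately have "p = 0"
    using assms t by (intro poly_eqI_degree[of "x ` {..<s}"]) (auto simp: card_image)
  then have "coeff p t = 0" by simp
  then show "b t = 0" using t by (simp add: p_def coeff_sum coeff_monom)
qed

section \<open>The catalecticant\<close>

definition idx_add :: "idx \<Rightarrow> idx \<Rightarrow> idx" where
  "idx_add \<alpha> \<beta> = (\<lambda>i j. \<alpha> i j + \<beta> i j)"

definition monom_at :: "nat \<Rightarrow> (nat \<Rightarrow> nat) \<Rightarrow> idx \<Rightarrow> (nat \<Rightarrow> nat \<Rightarrow> 'a::comm_semiring_1) \<Rightarrow> 'a" where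
  "monom_at k n \<alpha> u = (\<Prod>i<k. \<Prod>j\<le>n i. u i j ^ \<alpha> i j)"

lemma monom_at_idx_add: "monom_at k n (idx_add \<alpha> \<beta>) u = monom_at k n \<alpha> u * monom_at k n \<beta> u"
  by (simp add: monom_at_def idx_add_def power_add prod.distrib)

lemma idx_add_SVidx:
  "\<alpha> \<in> SVidx k n e \<Longrightarrow> \<beta> \<in> SVidx k n e' \<Longrightarrow> (\<And>i. i < k \<Longrightarrow> e i + e' i = d i)
    \<Longrightarrow> idx_add \<alpha> \<beta> \<in> SVidx k n d"
  by (auto simp: SVidx_def idx_add_def sum.distrib)

definition sv_point :: "nat \<Rightarrow> (nat \<Rightarrow> nat) \<Rightarrow> (nat \<Rightarrow> nat) \<Rightarrow> (nat \<Rightarrow> nat \<Rightarrow> 'a::field) \<Rightarrow> idx \<Rightarrow> 'a" where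
  "sv_point k n d u = (\<lambda>\<alpha>. if \<alpha> \<in> SVidx k n d then monom_at k n \<alpha> u else 0)"

text \<open>Neither nonzero blocks nor independence is asked of the parameters, so they fill an
  affine space and can be joined by lines.\<close>

definition sec_point :: "nat \<Rightarrow> nat \<Rightarrow> (nat \<Rightarrow> nat) \<Rightarrow> (nat \<Rightarrow> nat)
    \<Rightarrow> (nat \<Rightarrow> nat \<Rightarrow> nat \<Rightarrow> 'a::field) \<Rightarrow> (nat \<Rightarrow> 'a) \<Rightarrow> idx \<Rightarrow> 'a" where
  "sec_point s k n d u c = (\<lambda>\<alpha>. \<Sum>t<s. c t * sv_point k n d (u t) \<alpha>)"

definition secant_points :: "nat \<Rightarrow> nat \<Rightarrow> (nat \<Rightarrow> nat) \<Rightarrow> (nat \<Rightarrow> nat) \<Rightarrow> (idx \<Rightarrow> 'a::field) set" where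
  "secant_points s k n d = {w. \<exists>v c. (\<forall>t<s. v t \<in> SV_cone k n d) \<and> lin_indep s v \<and>
              w = (\<lambda>\<alpha>. \<Sum>t<s. c t * v t \<alpha>)}"

definition catmat :: "nat \<Rightarrow> (nat \<Rightarrow> idx) \<Rightarrow> (nat \<Rightarrow> idx) \<Rightarrow> (idx \<Rightarrow> 'a) \<Rightarrow> 'a mat" where
  "catmat m r c y = mat m m (\<lambda>(i, j). y (idx_add (r i) (c j)))"

lemma catmat_carrier [simp]: "catmat m r c y \<in> carrier_mat m m"
  by (simp add: catmat_def)

lemma secant_points_cases:
  assumes "w \<in> secant_points s k n d"
  obtains u c where "w = sec_point s k n d u c"
proof -
  obtain v c where v: "\<forall>t<s. v t \<in> SV_cone k n d" "w = (\<lambda>\<alpha>. \<Sum>t<s. c t * v t \<alpha>)"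
    using assms unfolding secant_points_def by auto
  then have "\<forall>t. \<exists>u. t < s \<longrightarrow> v t = sv_point k n d u"
    unfolding SV_cone_def sv_point_def monom_at_def by blast
  then obtain u where "\<And>t. t < s \<Longrightarrow> v t = sv_point k n d (u t)" by metis
  with v(2) have "w = sec_point s k n d u c" by (simp add: sec_point_def)
  then show ?thesis by (rule that)
qed

lemma secant_points_ambient: "secant_points s k n d \<subseteq> ambient (SVidx k n d)"
proof
  fix w :: "idx \<Rightarrow> 'a" assume "w \<in> secant_points s k n d"
  then obtain u c where "w = sec_point s k n d u c" by (rule secant_points_cases)
  then show "w \<in> ambient (SVidx k n d)" by (simp add: ambient_def sec_point_def sv_point_def)
qed

lemma polyfun_catmat_det:
  assumes "\<And>i j. i < m \<Longrightarrow> j < m \<Longrightarrow> idx_add (r i) (c j) \<in> J"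
  shows "(\<lambda>y. det (catmat m r c y)) \<in> polyfun J"
  by (rule polyfun_det) (auto simp: catmat_def intro!: pf_var assms)

text \<open>Laplace expansion along the last column: only the corner entry may lie outside
  \<open>J\<close>, and it occurs linearly with the smaller minor as coefficient.\<close>

lemma catmat_det_expand:
  assumes "\<And>i j. i \<le> m \<Longrightarrow> j \<le> m \<Longrightarrow> (i, j) \<noteq> (m, m) \<Longrightarrow> idx_add (r i) (c j) \<in> J"
  shows "\<exists>h\<in>polyfun J. \<forall>y :: idx \<Rightarrow> 'a::comm_ring_1. det (catmat (Suc m) r c y)
    = y (idx_add (r m) (c m)) * det (catmat m r c y) + h y"
proof -
  define h where "h y = (\<Sum>i<m. catmat (Suc m) r c y $$ (i, m) * cofactor (catmat (Suc m) r c y) i m)"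
    for y :: "idx \<Rightarrow> 'a"
  have del: "mat_delete (catmat (Suc m) r c y) m m = catmat m r c y" for y :: "idx \<Rightarrow> 'a"
    by (rule eq_matI) (auto simp: mat_delete_def catmat_def)
  have "det (catmat (Suc m) r c y) = y (idx_add (r m) (c m)) * det (catmat m r c y) + h y" for y
    using laplace_expansion_column[of "catmat (Suc m) r c y" "Suc m" m]
    by (simp add: h_def cofactor_def del) (simp add: catmat_def)
  moreover have "h \<in> polyfun J"
    unfolding h_def
  proof (rule polyfun_sum, rule pf_mult)
    fix i assume i: "i \<in> {..<m}"
    then show "(\<lambda>y. catmat (Suc m) r c y $$ (i, m)) \<in> polyfun J"
      by (auto simp: catmat_def intro!: pf_var assms)
    \<comment> \<open>Deleting the last column removes the corner entry, so every entry left lies in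
      \<open>J\<close>.\<close>
    have "(\<lambda>y. det (mat_delete (catmat (Suc m) r c y) i m)) \<in> polyfun J"
    proof (rule polyfun_det)
      show "mat_delete (catmat (Suc m) r c y) i m \<in> carrier_mat m m" for y
        using mat_delete_carrier[OF catmat_carrier, of "Suc m"] by simp
      show "(\<lambda>y. mat_delete (catmat (Suc m) r c y) i m $$ (i', j')) \<in> polyfun J"
        if "i' < m" "j' < m" for i' j'
        using that i by (auto simp: mat_delete_def catmat_def intro!: pf_var assms)
    qed
    then show "(\<lambda>y. cofactor (catmat (Suc m) r c y) i m) \<in> polyfun J"
      unfolding cofactor_def by (intro pf_mult pf_const)
  qed
  ultimately show ?thesis by blast
qed

text \<open>The monomial of a sum of exponents splits into a row factor and a column factor, so the
  matrix factors through the \<open>s\<close> summands; hence the rank bound.\<close>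

lemma catmat_sec_point:
  assumes "\<And>i j. i < m \<Longrightarrow> j < m \<Longrightarrow> idx_add (r i) (c j) \<in> SVidx k n d"
  shows "catmat m r c (sec_point s k n d u w) = mat m m (\<lambda>(i, j).
    \<Sum>t<s. monom_at k n (r i) (u t) * (w t * monom_at k n (c j) (u t)))"
  by (rule eq_matI)
     (auto simp: catmat_def sec_point_def sv_point_def assms monom_at_idx_add mult_ac intro!: sum.cong)

lemma catmat_det_zero:
  fixes u :: "nat \<Rightarrow> nat \<Rightarrow> nat \<Rightarrow> 'a::field"
  assumes "\<And>i j. i < Suc s \<Longrightarrow> j < Suc s \<Longrightarrow> idx_add (r i) (c j) \<in> SVidx k n d"
  shows "det (catmat (Suc s) r c (sec_point s k n d u w)) = 0"
proof -
  \<comment> \<open>\<open>s\<close> equations in \<open>Suc s\<close> unknowns: a nontrivial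
    combination of the column monomials vanishes at all \<open>s\<close> points.\<close>
  obtain b where b: "\<exists>j\<in>{..<Suc s}. b j \<noteq> 0"
    "\<forall>t\<in>{..<s}. (\<Sum>j\<in>{..<Suc s}. b j * monom_at k n (c j) (u t)) = 0"
    using exists_nontrivial_kernel[of "{..<s}" "{..<Suc s}" "\<lambda>j t. monom_at k n (c j) (u t)"] by auto
  have "(\<Sum>j<Suc s. (\<Sum>t<s. monom_at k n (r i) (u t) * (w t * monom_at k n (c j) (u t))) * b j) = 0" for i
  proof -
    have "(\<Sum>j<Suc s. (\<Sum>t<s. monom_at k n (r i) (u t) * (w t * monom_at k n (c j) (u t))) * b j)
      = (\<Sum>t<s. \<Sum>j<Suc s. monom_at k n (r i) (u t) * (w t * monom_at k n (c j) (u t)) * b j)"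
      unfolding sum_distrib_right by (rule sum.swap)
    also have "\<dots> = (\<Sum>t<s. monom_at k n (r i) (u t) * w t * (\<Sum>j<Suc s. b j * monom_at k n (c j) (u t)))"
      unfolding sum_distrib_left by (intro sum.cong refl) (simp add: mult_ac)
    also have "\<dots> = 0" using b(2) by (intro sum.neutral) simp
    finally show ?thesis .
  qed
  moreover have "catmat (Suc s) r c (sec_point s k n d u w) = mat (Suc s) (Suc s) (\<lambda>(i, j).
      \<Sum>t<s. monom_at k n (r i) (u t) * (w t * monom_at k n (c j) (u t)))"
    by (rule catmat_sec_point) (rule assms)
  ultimately have "\<not> det (catmat (Suc s) r c (sec_point s k n d u w)) \<noteq> 0"
    using b(1) unfolding det_nonzero_iff by (simp only: det_nonzero_iff) blast
  then show ?thesis by simp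
qed

lemma catmat_det_factor:
  fixes u :: "nat \<Rightarrow> nat \<Rightarrow> nat \<Rightarrow> 'a::field"
  assumes "\<And>i j. i < s \<Longrightarrow> j < s \<Longrightarrow> idx_add (r i) (c j) \<in> SVidx k n d"
  shows "det (catmat s r c (sec_point s k n d u w))
    = det (mat s s (\<lambda>(i, t). monom_at k n (r i) (u t)))
    * det (mat s s (\<lambda>(t, j). w t * monom_at k n (c j) (u t)))"
proof -
  have "catmat s r c (sec_point s k n d u w) = mat s s (\<lambda>(i, t). monom_at k n (r i) (u t))
      * mat s s (\<lambda>(t, j). w t * monom_at k n (c j) (u t))"
    by (subst catmat_sec_point, rule assms, assumption, assumption)
       (auto simp: scalar_prod_def atLeast0LessThan intro!: eq_matI)
  then show ?thesis by (simp add: det_mult[of _ s])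
qed

text \<open>A nonzero minor makes both factors nonsingular, which forces the \<open>s\<close> points
  to be independent. A zero block in the parameters is then excluded, because with
  \<open>d i > 0\<close> it would make the point zero.\<close>

lemma sec_point_in_secant_points:
  fixes u :: "nat \<Rightarrow> nat \<Rightarrow> nat \<Rightarrow> 'a::field"
  assumes rc: "\<And>i j. i < s \<Longrightarrow> j < s \<Longrightarrow> idx_add (r i) (c j) \<in> SVidx k n d"
    and d: "\<And>i. i < k \<Longrightarrow> d i > 0"
    and nz: "det (catmat s r c (sec_point s k n d u w)) \<noteq> 0"
  shows "sec_point s k n d u w \<in> secant_points s k n d"
proof -
  have P: "det (mat s s (\<lambda>(i, t). monom_at k n (r i) (u t))) \<noteq> 0"
    and Q: "det (mat s s (\<lambda>(t, j). w t * monom_at k n (c j) (u t))) \<noteq> 0"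
    using nz catmat_det_factor[of s r c k n d u w] rc by auto
  have Q': "det (mat s s (\<lambda>(j, t). w t * monom_at k n (c j) (u t))) \<noteq> 0"
    using Q by (subst det_mat_swap)
  define v where "v t = sv_point k n d (u t)" for t
  have li: "lin_indep s v"
    unfolding lin_indep_def
  proof (intro allI impI, rule ccontr)
    fix b t0 assume b: "\<forall>\<alpha>. (\<Sum>t<s. b t * v t \<alpha>) = 0" and t0: "t0 < s" "b t0 \<noteq> 0"
    \<comment> \<open>For fixed \<open>j\<close>, the dependency read at the coordinates
      \<open>idx_add (r i) (c j)\<close> is a kernel vector of the row factor.\<close>
    have "b t0 * monom_at k n (c j) (u t0) = 0" if "j < s" for j
    proof -
      have "(\<Sum>t<s. monom_at k n (r i) (u t) * (b t * monom_at k n (c j) (u t))) = 0" if "i < s" for i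
        using b[rule_format, of "idx_add (r i) (c j)"] rc[OF \<open>i < s\<close> \<open>j < s\<close>]
        by (simp add: v_def sv_point_def monom_at_idx_add mult_ac)
      then show ?thesis
        using P[unfolded det_nonzero_iff, rule_format, of "\<lambda>t. b t * monom_at k n (c j) (u t)" t0] t0 by blast
    qed
    then have "monom_at k n (c j) (u t0) = 0" if "j < s" for j using that t0 by simp
    \<comment> \<open>Column \<open>t0\<close> of the transposed column factor is zero, so the unit
      vector at \<open>t0\<close> lies in its kernel.\<close>
    then have "(\<Sum>t<s. w t * monom_at k n (c j) (u t) * (if t = t0 then 1 else 0)) = 0" if "j < s" for j
      using that t0 by (simp add: if_distrib[of "\<lambda>e. _ * e"] cong: if_cong)
    then show False
      using Q'[unfolded det_nonzero_iff, rule_format, of "\<lambda>t. if t = t0 then 1 else 0" t0] t0 by simp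
  qed
  have "\<exists>j\<le>n i. u t i j \<noteq> 0" if t: "t < s" and i: "i < k" for t i
  proof (rule ccontr)
    assume "\<not> (\<exists>j\<le>n i. u t i j \<noteq> 0)"
    then have 0: "u t i j = 0" if "j \<le> n i" for j using that by blast
    have "v t \<alpha> = 0" for \<alpha>
    proof (cases "\<alpha> \<in> SVidx k n d")
      case True
      then have "(\<Sum>j\<le>n i. \<alpha> i j) > 0" using d i by (auto simp: SVidx_def)
      then obtain j where j: "j \<le> n i" "\<alpha> i j \<noteq> 0"
        by (metis atMost_iff less_numeral_extra(3) sum.neutral)
      then have "(\<Prod>j\<le>n i. u t i j ^ \<alpha> i j) = 0" using 0 by (intro prod_zero) auto
      then have "monom_at k n \<alpha> (u t) = 0" using i unfolding monom_at_def by (intro prod_zero) auto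
      then show ?thesis by (simp add: v_def sv_point_def)
    qed (simp add: v_def sv_point_def)
    then have "\<forall>\<alpha>. (\<Sum>t'<s. (if t' = t then 1 else 0) * v t' \<alpha>) = 0"
      using t by (simp add: if_distrib[of "\<lambda>e. e * _"] cong: if_cong)
    with li t show False unfolding lin_indep_def
      by (auto dest!: spec[of _ "\<lambda>t'. if t' = t then 1 else 0"])
  qed
  then have "v t \<in> SV_cone k n d" if "t < s" for t
    using that unfolding SV_cone_def v_def sv_point_def monom_at_def by blast
  with li show ?thesis
    unfolding secant_points_def sec_point_def v_def[symmetric]
    by (intro CollectI exI[of _ v] exI[of _ w]) auto
qed

section \<open>Genericity\<close>

definition poly_in :: "('a::field \<Rightarrow> 'a) \<Rightarrow> bool" where
  "poly_in g \<longleftrightarrow> (\<exists>P. \<forall>x. g x = poly P x)"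

lemma poly_in_const: "poly_in (\<lambda>x. c)"
  unfolding poly_in_def by (rule exI[of _ "[:c:]"]) simp

lemma poly_in_add: "poly_in f \<Longrightarrow> poly_in g \<Longrightarrow> poly_in (\<lambda>x. f x + g x)"
  unfolding poly_in_def by (metis poly_add)

lemma poly_in_mult: "poly_in f \<Longrightarrow> poly_in g \<Longrightarrow> poly_in (\<lambda>x. f x * g x)"
  unfolding poly_in_def by (metis poly_mult)

lemma poly_in_affine: "poly_in (\<lambda>x. a + x * b)"
  unfolding poly_in_def by (rule exI[of _ "[:a, b:]"]) simp

lemma poly_in_power: "poly_in f \<Longrightarrow> poly_in (\<lambda>x. f x ^ m)"
  by (induction m) (auto intro: poly_in_const poly_in_mult)

lemma poly_in_prod: "(\<And>a. a \<in> A \<Longrightarrow> poly_in (f a)) \<Longrightarrow> poly_in (\<lambda>x. \<Prod>a\<in>A. f a x)"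
proof (induction A rule: infinite_finite_induct)
  case (insert a A)
  then show ?case using poly_in_mult[of "f a" "\<lambda>x. \<Prod>a\<in>A. f a x"] by simp
qed (auto intro: poly_in_const)

lemma poly_in_sum: "(\<And>a. a \<in> A \<Longrightarrow> poly_in (f a)) \<Longrightarrow> poly_in (\<lambda>x. \<Sum>a\<in>A. f a x)"
proof (induction A rule: infinite_finite_induct)
  case (insert a A)
  then show ?case using poly_in_add[of "f a" "\<lambda>x. \<Sum>a\<in>A. f a x"] by simp
qed (auto intro: poly_in_const)

lemma poly_in_polyfun:
  assumes "p \<in> polyfun I" "\<And>\<alpha>. poly_in (\<lambda>x. F x \<alpha>)"
  shows "poly_in (\<lambda>x. p (F x))"
  using assms(1)
  by (induction rule: polyfun.induct) (auto intro: poly_in_const poly_in_add poly_in_mult assms(2))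

text \<open>The product of the two polynomials is nonzero and has finitely many roots, while a field
  of characteristic 0 is infinite.\<close>

lemma poly_in_common_nonzero:
  fixes f g :: "'a::field_char_0 \<Rightarrow> 'a"
  assumes "poly_in f" "poly_in g" "f a \<noteq> 0" "g b \<noteq> 0"
  obtains x where "f x \<noteq> 0" "g x \<noteq> 0"
proof -
  obtain P Q where P: "\<And>x. f x = poly P x" and Q: "\<And>x. g x = poly Q x"
    using assms(1,2) unfolding poly_in_def by blast
  have "P * Q \<noteq> 0" using assms(3,4) P Q by auto
  then have "finite {x. poly (P * Q) x = 0}" by (rule poly_roots_finite)
  then obtain x where "poly (P * Q) x \<noteq> 0"
    using ex_new_if_finite[OF infinite_UNIV_char_0, of "{x. poly (P * Q) x = 0}"] by auto
  then show ?thesis using that[of x] P Q by simp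
qed

lemma poly_in_sec_point:
  fixes u u' :: "nat \<Rightarrow> nat \<Rightarrow> nat \<Rightarrow> 'a::field"
  shows "poly_in (\<lambda>x. sec_point s k n d (\<lambda>t i j. u t i j + x * (u' t i j - u t i j))
    (\<lambda>t. w t + x * (w' t - w t)) \<alpha>)"
  unfolding sec_point_def sv_point_def monom_at_def
  by (cases "\<alpha> \<in> SVidx k n d")
     (auto intro!: poly_in_sum poly_in_mult poly_in_prod poly_in_power poly_in_affine poly_in_const)

text \<open>The parameters of secant points form an affine space, so two nonvanishing conditions can be met
  simultaneously on the line joining a solution of each.\<close>

lemma catmat_det_nonzero_divisor:
  fixes p :: "(idx \<Rightarrow> 'a::field_char_0) \<Rightarrow> 'a"
  assumes rc: "\<And>i j. i < s \<Longrightarrow> j < s \<Longrightarrow> idx_add (r i) (c j) \<in> SVidx k n d"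
    and d: "\<And>i. i < k \<Longrightarrow> d i > 0"
    and nz: "det (catmat s r c (sec_point s k n d u' w')) \<noteq> (0 :: 'a)"
    and p: "p \<in> polyfun (SVidx k n d)"
    and van: "\<And>y. y \<in> secant_points s k n d \<Longrightarrow> p y * det (catmat s r c y) = 0"
    and y: "y \<in> secant_points s k n d"
  shows "p y = 0"
proof (rule ccontr)
  assume py: "p y \<noteq> 0"
  obtain u w where y': "y = sec_point s k n d u w" using y by (rule secant_points_cases)
  define F where "F x = sec_point s k n d (\<lambda>t i j. u t i j + x * (u' t i j - u t i j))
    (\<lambda>t. w t + x * (w' t - w t))" for x
  have F: "poly_in (\<lambda>x. F x \<alpha>)" for \<alpha> unfolding F_def by (rule poly_in_sec_point)
  have D: "(\<lambda>y. det (catmat s r c y)) \<in> polyfun (SVidx k n d)"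
    by (rule polyfun_catmat_det) (rule rc)
  have F0: "p (F 0) \<noteq> 0" and F1: "det (catmat s r c (F 1)) \<noteq> 0"
    using py nz y' by (simp_all add: F_def)
  obtain x where x: "p (F x) \<noteq> 0" "det (catmat s r c (F x)) \<noteq> 0"
    using poly_in_common_nonzero[OF poly_in_polyfun[OF p F] poly_in_polyfun[OF D F] F0 F1] .
  \<comment> \<open>The nonzero minor also certifies that this point of the line is a genuine secant
    point, so \<open>van\<close> applies to it.\<close>
  have "F x \<in> secant_points s k n d"
    using x(2) unfolding F_def by (intro sec_point_in_secant_points[OF rc d])
  from van[OF this] x show False by simp
qed

section \<open>Points with prime coordinates\<close>

definition prime_pt :: "nat \<Rightarrow> nat \<Rightarrow> nat" where
  "prime_pt i j = enumerate {p. prime p} (prod_encode (i, j))"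

lemma prime_prime_pt: "prime (prime_pt i j)"
  using enumerate_in_set[OF primes_infinite] unfolding prime_pt_def by blast

lemma prime_pt_eq_iff: "prime_pt i j = prime_pt i' j' \<longleftrightarrow> i = i' \<and> j = j'"
  unfolding prime_pt_def
  using strict_mono_eq[OF strict_mono_enumerate[OF primes_infinite]]
  by (metis prod.inject prod_encode_eq)

text \<open>Different variables receive different primes, so unique factorisation recovers the
  exponents as multiplicities.\<close>

lemma monom_at_prime_pt_inj:
  assumes "\<alpha> \<in> SVidx k n d" "\<beta> \<in> SVidx k n d"
    and "monom_at k n \<alpha> prime_pt = monom_at k n \<beta> prime_pt"
  shows "\<alpha> = \<beta>"
proof -
  define S where "S = Sigma {..<k} (\<lambda>i. {..n i})"
  define q where "q = (\<lambda>(i, j). prime_pt i j)"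
  have inj: "inj_on q S" by (auto simp: inj_on_def q_def prime_pt_eq_iff)
  have fin: "finite S" by (simp add: S_def)
  have mult: "multiplicity (q x) (monom_at k n \<gamma> prime_pt) = case_prod \<gamma> x" if "x \<in> S" for \<gamma> x
  proof -
    have "monom_at k n \<gamma> prime_pt = (\<Prod>x\<in>S. q x ^ case_prod \<gamma> x)"
      unfolding monom_at_def S_def by (subst prod.Sigma) (auto simp: q_def intro!: prod.cong)
    also have "\<dots> = (\<Prod>p\<in>q ` S. p ^ case_prod \<gamma> (inv_into S q p))"
      using inj by (simp add: prod.reindex)
    finally show ?thesis
      using that inj fin
      by (simp only:, subst multiplicity_prod_prime_powers) (auto simp: q_def prime_prime_pt split: prod.splits)
  qed
  have "\<alpha> i j = \<beta> i j" if "i < k" "j \<le> n i" for i j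
    using mult[of "(i, j)" \<alpha>] mult[of "(i, j)" \<beta>] assms(3) that by (simp add: S_def)
  then show ?thesis
    using assms(1,2) by (auto simp: SVidx_def fun_eq_iff) (metis not_le)
qed

text \<open>At the \<open>t\<close>-th point each monomial takes the \<open>t\<close>-th power of
  its value at the primes. Up to transposition both factors are Vandermonde matrices, whose nodes
  stay distinct in characteristic 0.\<close>

lemma catmat_det_nonzero_at_prime_powers:
  assumes r: "inj_on r {..<s}" "r ` {..<s} \<subseteq> SVidx k n e"
    and c: "inj_on c {..<s}" "c ` {..<s} \<subseteq> SVidx k n e'"
    and rc: "\<And>i j. i < s \<Longrightarrow> j < s \<Longrightarrow> idx_add (r i) (c j) \<in> SVidx k n d"
  shows "det (catmat s r c (sec_point s k n d (\<lambda>t i j. of_nat (prime_pt i j) ^ t) (\<lambda>t. 1)))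
    \<noteq> (0 :: 'a::field_char_0)"
proof -
  let ?m = "\<lambda>\<alpha>. of_nat (monom_at k n \<alpha> prime_pt) :: 'a"
  have mon: "monom_at k n \<alpha> (\<lambda>i j. of_nat (prime_pt i j) ^ t) = ?m \<alpha> ^ t" for \<alpha> t
    by (simp add: monom_at_def prod_power_distrib flip: power_mult) (simp add: mult.commute)
  have inj: "inj_on (\<lambda>i. ?m (h i)) {..<s}" if "inj_on h {..<s}" "h ` {..<s} \<subseteq> SVidx k n e" for h e
  proof (rule inj_onI)
    fix i j assume ij: "i \<in> {..<s}" "j \<in> {..<s}" "?m (h i) = ?m (h j)"
    then have "h i = h j" using that(2) by (intro monom_at_prime_pt_inj[of _ k n e]) auto
    with ij that(1) show "i = j" by (auto dest: inj_onD)
  qed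
  have "det (mat s s (\<lambda>(i, t). ?m (r i) ^ t)) \<noteq> 0"
    using vandermonde_det_nonzero[OF inj[OF r]] .
  moreover have "det (mat s s (\<lambda>(t, j). ?m (c j) ^ t)) \<noteq> 0"
    using vandermonde_det_nonzero[OF inj[OF c]] by (subst det_mat_swap)
  ultimately show ?thesis
    using catmat_det_factor[of s r c k n d "\<lambda>t i j. of_nat (prime_pt i j) ^ t :: 'a" "\<lambda>t. 1"] rc
    unfolding mon by simp
qed

section \<open>The secant variety\<close>

text \<open>\<open>R\<close> and \<open>R'\<close> are the rows and columns whose crossings get
  eliminated; \<open>unique\<close> says that a crossing coordinate has no second place in the
  catalecticant. The sum form avoids truncated subtraction.\<close>

theorem krull_dim_secant_cone_le:
  fixes k s :: nat
  assumes d: "\<And>i. i < k \<Longrightarrow> d i > 0" and e: "\<And>i. i < k \<Longrightarrow> e i + e' i = d i"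
    and R: "R \<subseteq> SVidx k n e" "card R + s = Nnd k n e"
    and R': "R' \<subseteq> SVidx k n e'" "card R' + s = Nnd k n e'"
    and unique: "\<And>\<rho> \<kappa> \<rho>' \<kappa>'. \<rho> \<in> R \<Longrightarrow> \<kappa> \<in> R' \<Longrightarrow> \<rho>' \<in> SVidx k n e \<Longrightarrow> \<kappa>' \<in> SVidx k n e'
      \<Longrightarrow> idx_add \<rho>' \<kappa>' = idx_add \<rho> \<kappa> \<Longrightarrow> \<rho>' = \<rho> \<and> \<kappa>' = \<kappa>"
  shows "krull_dim (SVidx k n d) (secant_cone s k n d :: (idx \<Rightarrow> 'a::field_char_0) set)
    + enat (card R * card R') \<le> enat (Nnd k n d)"
proof -
  define I where "I = SVidx k n d"
  define X where "X = (\<lambda>(\<rho>, \<kappa>). idx_add \<rho> \<kappa>) ` (R \<times> R')"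
  define J where "J = I - X"
  let ?Y = "secant_cone s k n d :: (idx \<Rightarrow> 'a) set"
  have Y: "?Y = zariski_closure I (secant_points s k n d)"
    by (simp add: secant_cone_def secant_points_def I_def)
  have XI: "X \<subseteq> I" using R R' e unfolding X_def I_def by (auto intro!: idx_add_SVidx)
  have finR: "finite R" "finite R'" using R(1) R'(1) finite_SVidx finite_subset by blast+
  have "inj_on (\<lambda>(\<rho>, \<kappa>). idx_add \<rho> \<kappa>) (R \<times> R')"
  proof (rule inj_onI, clarify)
    fix a b a' b' assume "a \<in> R" "b \<in> R'" "a' \<in> R" "b' \<in> R'" "idx_add a b = idx_add a' b'"
    then show "a = a' \<and> b = b'" using unique[of a' b' a b] R(1) R'(1) by auto
  qed
  then have cX: "card X = card R * card R'" unfolding X_def by (simp add: card_image card_cartesian_product)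
  have cJ: "card J + card R * card R' = Nnd k n d"
    using card_Diff_subset[of X I] card_mono[of I X] XI finite_SVidx[of k n d] card_SVidx[of k n d]
    by (simp add: finite_subset I_def J_def cX)
  have "card (SVidx k n e - R) = s" "card (SVidx k n e' - R') = s"
    using R R' finR by (simp_all add: card_Diff_subset card_SVidx)
  \<comment> \<open>The \<open>s\<close> rows and \<open>s\<close> columns left over; their minor is
    \<Delta>.\<close>
  then obtain r c where r: "bij_betw r {..<s} (SVidx k n e - R)" and c: "bij_betw c {..<s} (SVidx k n e' - R')"
    using finite_same_card_bij[of "{..<s}" "SVidx k n e - R"]
      finite_same_card_bij[of "{..<s}" "SVidx k n e' - R'"] finite_SVidx by auto
  have rI: "r i \<in> SVidx k n e" "r i \<notin> R" and cI: "c i \<in> SVidx k n e'" "c i \<notin> R'" if "i < s" for i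
    using r c that unfolding bij_betw_def by auto
  have in_J: "idx_add \<rho> \<kappa> \<in> J"
    if "\<rho> \<in> SVidx k n e" "\<kappa> \<in> SVidx k n e'" "\<rho> \<notin> R \<or> \<kappa> \<notin> R'" for \<rho> \<kappa>
  proof -
    have "idx_add \<rho> \<kappa> \<in> I" using that e unfolding I_def by (auto intro!: idx_add_SVidx)
    moreover have "idx_add \<rho> \<kappa> \<notin> X" using unique[OF _ _ that(1,2)] that(3) unfolding X_def by auto
    ultimately show ?thesis by (simp add: J_def)
  qed
  have rcJ: "idx_add (r i) (c j) \<in> J" if "i < s" "j < s" for i j
    using in_J rI cI that by blast
  then have rc: "idx_add (r i) (c j) \<in> SVidx k n d" if "i < s" "j < s" for i j
    using that by (auto simp: J_def I_def)
  define \<Delta> :: "(idx \<Rightarrow> 'a) \<Rightarrow> 'a" where "\<Delta> y = det (catmat s r c y)" for y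
  have \<Delta>: "\<Delta> \<in> polyfun J" unfolding \<Delta>_def by (rule polyfun_catmat_det) (rule rcJ)
  have num: "clears J ?Y \<Delta> (\<lambda>y. y \<alpha>) 1" if mem: "\<alpha> \<in> I - J" for \<alpha>
  proof -
    obtain \<rho> \<kappa> where \<alpha>: "\<rho> \<in> R" "\<kappa> \<in> R'" "\<alpha> = idx_add \<rho> \<kappa>"
      using mem unfolding J_def X_def by auto
    \<comment> \<open>\<Delta> is bordered by row \<rho> and column \<kappa>, placed at index
      \<open>s\<close>, so that \<alpha> is the corner.\<close>
    define r' c' where "r' = r(s := \<rho>)" and "c' = c(s := \<kappa>)"
    have r'I: "r' i \<in> SVidx k n e" and c'I: "c' i \<in> SVidx k n e'" if "i \<le> s" for i
      using that rI cI \<alpha> R(1) R'(1) by (auto simp: r'_def c'_def)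
    have "idx_add (r' i) (c' j) \<in> J" if "i \<le> s" "j \<le> s" "(i, j) \<noteq> (s, s)" for i j
      using that rI cI r'I c'I by (intro in_J) (auto simp: r'_def c'_def)
    then have "\<exists>h\<in>polyfun J. \<forall>y :: idx \<Rightarrow> 'a. det (catmat (Suc s) r' c' y)
        = y (idx_add (r' s) (c' s)) * det (catmat s r' c' y) + h y"
      by (rule catmat_det_expand)
    moreover have "catmat s r' c' y = catmat s r c y" for y :: "idx \<Rightarrow> 'a"
      by (rule eq_matI) (auto simp: catmat_def r'_def c'_def)
    ultimately obtain h where h: "h \<in> polyfun J"
      "\<And>y. det (catmat (Suc s) r' c' y) = y \<alpha> * \<Delta> y + h y"
      using \<alpha> by (auto simp: \<Delta>_def r'_def c'_def)
    have r'c': "idx_add (r' i) (c' j) \<in> SVidx k n d" if "i < Suc s" "j < Suc s" for i j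
      using that r'I c'I e by (intro idx_add_SVidx) auto
    have "det (catmat (Suc s) r' c' y) = 0" if "y \<in> ?Y" for y
    proof (rule vanish_on_zariski_closure[where p = "\<lambda>y. det (catmat (Suc s) r' c' y)",
          OF _ secant_points_ambient])
      show "(\<lambda>y. det (catmat (Suc s) r' c' y)) \<in> polyfun (SVidx k n d)"
        by (rule polyfun_catmat_det) (rule r'c')
      show "y \<in> zariski_closure (SVidx k n d) (secant_points s k n d)" using that Y by (simp add: I_def)
      fix x :: "idx \<Rightarrow> 'a" assume "x \<in> secant_points s k n d"
      then obtain u w where "x = sec_point s k n d u w" by (rule secant_points_cases)
      moreover have "det (catmat (Suc s) r' c' (sec_point s k n d u w)) = 0"
        by (rule catmat_det_zero) (rule r'c')
      ultimately show "det (catmat (Suc s) r' c' x) = 0" by simp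
    qed
    \<comment> \<open>Vanishing of the bordered minor turns its expansion into a fraction for
      \<alpha> with numerator \<open>- h\<close>.\<close>
    then have "\<forall>y\<in>?Y. y \<alpha> * \<Delta> y ^ 1 = - 1 * h y" using h(2) by (simp add: add_eq_0_iff2)
    then show ?thesis unfolding clears_def
      by (rule bexI[OF _ pf_mult[OF pf_const h(1)]])
  qed
  have nz: "\<Delta> (sec_point s k n d (\<lambda>t i j. of_nat (prime_pt i j) ^ t) (\<lambda>t. 1)) \<noteq> 0"
    unfolding \<Delta>_def
    using r c rc by (intro catmat_det_nonzero_at_prime_powers[of r s k n e c e'])
      (auto simp: bij_betw_def)
  have nzd: "\<forall>y\<in>?Y. p y = 0" if p: "p \<in> polyfun I" and van: "\<forall>y\<in>?Y. p y * \<Delta> y = 0" for p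
  proof
    fix y assume y: "y \<in> ?Y"
    have sub: "secant_points s k n d \<subseteq> ?Y" unfolding Y zariski_closure_def by auto
    \<comment> \<open>Cancellation is done on the parametrised secant points; the vanishing of
      \<open>p\<close> then extends to their closure.\<close>
    have "p x = 0" if x: "x \<in> secant_points s k n d" for x
    proof (rule catmat_det_nonzero_divisor[where r = r and c = c,
          OF rc d nz[unfolded \<Delta>_def] p[unfolded I_def] _ x])
      show "p y * det (catmat s r c y) = 0" if "y \<in> secant_points s k n d" for y
        using van that sub by (auto simp: \<Delta>_def)
    qed
    then show "p y = 0"
      using vanish_on_zariski_closure[OF p[unfolded I_def] secant_points_ambient, of s y] y Y
      by (simp add: I_def)
  qed
  have "krull_dim I ?Y \<le> enat (card J)"
  proof (rule krull_dim_le_card[OF _ _ \<Delta>])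
    show "finite J" "J \<subseteq> I" by (auto simp: J_def I_def finite_SVidx)
    show "clears J ?Y \<Delta> (\<lambda>y. y \<alpha>) 1" if "\<alpha> \<in> I - J" for \<alpha> using num[OF that] .
    show "\<forall>p\<in>polyfun I. (\<forall>y\<in>?Y. p y * \<Delta> y = 0) \<longrightarrow> (\<forall>y\<in>?Y. p y = 0)"
      using nzd by (intro ballI[of "polyfun I"] impI)
  qed
  then have "krull_dim I ?Y + enat (card R * card R') \<le> enat (card J) + enat (card R * card R')"
    by (rule add_right_mono)
  then show ?thesis by (simp add: cJ I_def)
qed

section \<open>Pure rows and columns\<close>

text \<open>Block \<open>i0\<close> has degree 1, so each variable chosen there, with the first
  variable in every other block, gives a different monomial. Its \<open>n i0 + 1\<close> variables
  leave room for \<open>a\<close> choices.\<close>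

lemma exists_pure_indices:
  assumes i0: "i0 < k" "i0 \<noteq> l" "e i0 = (1::nat)" and l: "l < k" and a: "a \<le> n i0"
  shows "\<exists>R \<subseteq> SVidx k n e. card R = a \<and> (\<forall>\<rho>\<in>R. \<rho> l 0 = e l)"
proof -
  define \<rho> :: "nat \<Rightarrow> idx" where "\<rho> j = (\<lambda>i j'. if i < k then
    (if i = i0 then (if j' = j then 1 else 0) else (if j' = 0 then e i else 0)) else 0)" for j
  have "inj \<rho>"
  proof (rule injI)
    fix x y assume "\<rho> x = \<rho> y"
    then have "\<rho> x i0 x = \<rho> y i0 x" by simp
    moreover have "\<rho> x i0 x = 1" "\<rho> y i0 x = (if x = y then 1 else 0)"
      using i0(1) by (simp_all add: \<rho>_def)
    ultimately show "x = y" by presburger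
  qed
  then have "card (\<rho> ` {..<a}) = a" by (simp add: card_image inj_on_subset)
  moreover have "\<rho> ` {..<a} \<subseteq> SVidx k n e"
  proof clarify
    fix j assume j: "j < a"
    have "(\<Sum>j'\<le>n i. \<rho> j i j') = e i" if "i < k" for i
      using that i0 a j by (cases "i = i0") (simp_all add: \<rho>_def)
    then show "\<rho> j \<in> SVidx k n e" using a j i0(1) by (auto simp: SVidx_def) (auto simp: \<rho>_def)
  qed
  moreover have "\<forall>\<rho>\<in>\<rho> ` {..<a}. \<rho> l 0 = e l" using i0 l by (auto simp: \<rho>_def)
  ultimately show ?thesis by blast
qed

lemma SVidx_pure:
  assumes "\<rho> \<in> SVidx k n e" "l < k" "\<rho> l 0 = e l" "j \<noteq> 0"
  shows "\<rho> l j = 0"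
proof (cases "j \<le> n l")
  case True
  have "(\<Sum>j\<in>{0, j}. \<rho> l j) \<le> (\<Sum>j\<le>n l. \<rho> l j)" using True by (intro sum_mono2) auto
  also have "\<dots> = e l" using assms by (simp add: SVidx_def)
  finally show ?thesis using assms by simp
qed (use assms in \<open>auto simp: SVidx_def\<close>)

text \<open>A monomial that is a pure power of the first variable in the only block shared by \<open>e\<close> and \<open>e'\<close>
  occurs only once in the catalecticant.\<close>

lemma idx_add_unique_decomposition:
  assumes l: "l < k" and disj: "\<And>i. i < k \<Longrightarrow> i \<noteq> l \<Longrightarrow> e i = 0 \<or> e' i = 0"
    and \<rho>: "\<rho> \<in> SVidx k n e" "\<rho> l 0 = e l" and \<kappa>: "\<kappa> \<in> SVidx k n e'" "\<kappa> l 0 = e' l"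
    and \<rho>': "\<rho>' \<in> SVidx k n e" and \<kappa>': "\<kappa>' \<in> SVidx k n e'"
    and eq: "idx_add \<rho>' \<kappa>' = idx_add \<rho> \<kappa>"
  shows "\<rho>' = \<rho> \<and> \<kappa>' = \<kappa>"
proof -
  have eq': "\<rho>' i j + \<kappa>' i j = \<rho> i j + \<kappa> i j" for i j
    using eq by (simp add: idx_add_def fun_eq_iff)
  \<comment> \<open>Each summand is at most its block degree, and their sum reaches the total of
    both, so both bounds are attained.\<close>
  have l0: "\<rho>' l 0 = e l" "\<kappa>' l 0 = e' l"
    using eq'[of l 0] \<rho>(2) \<kappa>(2) SVidx_le[OF \<rho>' l, of 0] SVidx_le[OF \<kappa>' l, of 0] by auto
  have "\<rho>' i j = \<rho> i j" for i j
  proof -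
    consider "i \<ge> k" | "i < k" "i \<noteq> l" | "i = l" "j = 0" | "i = l" "j \<noteq> 0"
      using not_le by blast
    then show ?thesis
    proof cases
      case 1
      then show ?thesis using SVidx_outside[OF \<rho>(1), of i j] SVidx_outside[OF \<rho>', of i j] by simp
    next
      case 2
      from disj[OF this] show ?thesis
        using SVidx_zero[OF \<rho>(1), of i j] SVidx_zero[OF \<rho>', of i j]
          SVidx_zero[OF \<kappa>(1), of i j] SVidx_zero[OF \<kappa>', of i j] eq'[of i j] by linarith
    next
      case 3
      then show ?thesis using l0 \<rho> by simp
    next
      case 4
      then show ?thesis using SVidx_pure[OF \<rho>(1) l \<rho>(2), of j] SVidx_pure[OF \<rho>' l l0(1), of j] by simp
    qed
  qed
  moreover from this have "\<kappa>' i j = \<kappa> i j" for i j using eq'[of i j] by simp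
  ultimately show ?thesis by (intro conjI ext)
qed

theorem mainTheorem2:
  fixes K :: "'a::field_char_0 itself"
    and k s :: nat and n d e0 :: "nat \<Rightarrow> nat"
  assumes "alg_closed K"
    and "k \<ge> 2"
    and "\<forall>i<k. n i > 0"
    and "\<forall>i<k - 1. d i = 1"
    and "d (k - 1) \<ge> 2"
    and "\<forall>j<k. e0 j \<le> d j"
    and "1 \<le> e0 (k - 1)" and "e0 (k - 1) \<le> d (k - 1) - 1"
    and "\<forall>e\<in>{e0, \<lambda>j. d j - e0 j}. \<exists>j\<in>Lam k e. j \<le> k - 2"
    and "s > 0"
    and "\<forall>e\<in>{e0, \<lambda>j. d j - e0 j}.
           int (Nnd k n e) - int (\<Sum>j\<in>Lam k e. n j) + 1 \<le> int s"
    and "\<forall>e\<in>{e0, \<lambda>j. d j - e0 j}.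
           int (n (Min (Lam k e))) \<ge> int (Nnd k n e) - int s \<and> int (Nnd k n e) - int s > 0"
  shows "secant_dim K s k n d \<le> ereal (real_of_int (
     (let e1 = (\<lambda>j. d j - e0 j);
          N0 = int (Nnd k n e0); N1 = int (Nnd k n e1);
          D = int (Dn k n);
          E = D - ((N0 - int s) + (N1 - int s))
      in int s * (D - E) + int (Nnd k n d) - 1
         - (N1 * (N0 - int s) + N0 * (N1 - int s))
         + (N0 - int s) * (N1 - int s))))"
proof -
  define e1 where "e1 = (\<lambda>j. d j - e0 j)"
  define l where "l = k - 1"
  have l: "l < k" "i < k \<Longrightarrow> i \<noteq> l \<Longrightarrow> i < k - 1" for i using assms(2) by (auto simp: l_def)
  have e01: "e0 i + e1 i = d i" if "i < k" for i using assms(6) that by (simp add: e1_def)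
  have dpos: "d i > 0" if "i < k" for i
    using assms(4,5) l(2)[of i] that by (cases "i = l") (auto simp: l_def)
  \<comment> \<open>Off the last block \<open>d i = 1\<close>, so only one of the two summands can
    be nonzero.\<close>
  have disj: "e0 i = 0 \<or> e1 i = 0" if "i < k" "i \<noteq> l" for i
    using e01[OF that(1)] assms(4) l(2)[OF that] by auto
  have ex: "\<exists>R \<subseteq> SVidx k n e. card R + s = Nnd k n e \<and> (\<forall>\<rho>\<in>R. \<rho> l 0 = e l)"
    if e: "e \<in> {e0, e1}" for e
  proof -
    define i0 where "i0 = Min (Lam k e)"
    \<comment> \<open>An index at most \<open>k - 2\<close> in \<open>Lam k e\<close> keeps the
      minimum \<open>i0\<close> out of the last block, whence \<open>e i0 = 1\<close>.\<close>
    obtain j where j: "j \<in> Lam k e" "j \<le> k - 2" using assms(9) e by (auto simp: e1_def)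
    have fin: "finite (Lam k e)" by (simp add: Lam_def)
    have "i0 \<in> Lam k e" "i0 \<le> j" unfolding i0_def using fin j by (auto intro: Min_in Min_le)
    then have i0: "i0 < k" "e i0 \<noteq> 0" "i0 < k - 1" using j assms(2) by (auto simp: Lam_def)
    moreover have "e i0 \<le> d i0" using e e01[OF i0(1)] by auto
    ultimately have "e i0 = 1" using assms(4) by fastforce
    \<comment> \<open>(C1) over the naturals; the strict inequality keeps the subtraction from
      truncating.\<close>
    moreover have "Nnd k n e - s \<le> n i0" "Nnd k n e > s"
      using assms(12) e by (auto simp: e1_def i0_def)
    ultimately show ?thesis
      using exists_pure_indices[of i0 k l e "Nnd k n e - s" n] i0 l(1)
      by (force simp: l_def)
  qed
  obtain R where R: "R \<subseteq> SVidx k n e0" "card R + s = Nnd k n e0" "\<And>\<rho>. \<rho> \<in> R \<Longrightarrow> \<rho> l 0 = e0 l"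
    using ex[of e0] by auto
  obtain R' where R': "R' \<subseteq> SVidx k n e1" "card R' + s = Nnd k n e1" "\<And>\<rho>. \<rho> \<in> R' \<Longrightarrow> \<rho> l 0 = e1 l"
    using ex[of e1] by auto
  let ?Y = "secant_cone s k n d :: (idx \<Rightarrow> 'a) set"
  have "krull_dim (SVidx k n d) ?Y + enat (card R * card R') \<le> enat (Nnd k n d)"
  proof (rule krull_dim_secant_cone_le[OF dpos e01 R(1,2) R'(1,2)])
    fix \<rho> \<kappa> \<rho>' \<kappa>'
    assume "\<rho> \<in> R" "\<kappa> \<in> R'" "\<rho>' \<in> SVidx k n e0" "\<kappa>' \<in> SVidx k n e1" "idx_add \<rho>' \<kappa>' = idx_add \<rho> \<kappa>"
    with R(1,3) R'(1,3) show "\<rho>' = \<rho> \<and> \<kappa>' = \<kappa>"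
      by (intro idx_add_unique_decomposition[OF l(1) disj]) auto
  qed
  \<comment> \<open>A finite bound on the sum makes the dimension itself finite.\<close>
  then obtain m where m: "krull_dim (SVidx k n d) ?Y = enat m" "m + card R * card R' \<le> Nnd k n d"
    by (cases "krull_dim (SVidx k n d) ?Y") auto
  have N: "int (Nnd k n e0) = int (card R) + int s" "int (Nnd k n e1) = int (card R') + int s"
    using R(2) R'(2) by linarith+
  have mle: "int m \<le> int (Nnd k n d) - int (card R) * int (card R')"
    using m(2) by (simp flip: of_nat_mult)
  \<comment> \<open>Let \<open>a0 = card R\<close> and \<open>a1 = card R'\<close>. Then
    \<open>s * (D - E)\<close> is \<open>s * (a0 + a1)\<close> and the subtracted sum is
    \<open>s * (a0 + a1) + 2 * a0 * a1\<close>, so a single \<open>a0 * a1\<close> is lost.\<close>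
  have F: "(let e1 = (\<lambda>j. d j - e0 j);
          N0 = int (Nnd k n e0); N1 = int (Nnd k n e1);
          D = int (Dn k n);
          E = D - ((N0 - int s) + (N1 - int s))
      in int s * (D - E) + int (Nnd k n d) - 1
         - (N1 * (N0 - int s) + N0 * (N1 - int s))
         + (N0 - int s) * (N1 - int s))
      = int (Nnd k n d) - 1 - int (card R) * int (card R')"
    unfolding Let_def e1_def[symmetric] N by (simp add: algebra_simps)
  have "secant_dim K s k n d = ereal (real_of_int (int m - 1))"
    by (simp add: secant_dim_def m(1) one_ereal_def)
  also have "\<dots> \<le> ereal (real_of_int (int (Nnd k n d) - 1 - int (card R) * int (card R')))"
    unfolding ereal_less_eq of_int_le_iff using mle by linarith
  finally show ?thesis unfolding F .
qed

end
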